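(* Let $F$ be a field and let $A\in M_q(F)$ be a square matrix of index $t_0$ whose characteristic polynomial splits over $F$. Let $\pmb{A}=(A^k)_{k\ge 0}$, let $A_d$ be the Drazin inverse of $A$, let $\pmb{A}_d=(A_d^k)_{k\ge 0}$, and let $\pi_0$ be the spectral projection of $A$ at $0$. Then $$\pmb{A}_d=\widetilde{\theta}_0(\pmb{A})+\pmb{0}_0\pi_0 .$$
   Context: $\mathcal{C}_F$ is the $F$-algebra of all sequences $(s_k)_{k\ge 0}$ over $F$ with componentwise operations. Sequences of $q\times q$ matrices over $F$ are identified with elements of $M_q(\mathcal{C}_F)$; zeroth powers of matrices are $I_q$. For $\lambda\in F\setminus\{0\}$, $\pmb{\lambda}=(\lambda^k)_{k\ge0}$; $\mathcal{S}^{\ast}=\{\pmb{\lambda}:\lambda\in F,\lambda\ne0\}$; for $i\in\mathbb{N}$, $\pmb{0}_i$ is the sequence with $\pmb{0}_i(k)=\delta_{ik}$; $\mathcal{S}^{\circ}=\{\pmb{0}_i: i\ge 0\}$. $F_{\mathcal{S}^{\ast}}$ and $F_{\mathcal{S}^{\circ}}$ are the $F$-spans of $\mathcal{S}^{\ast}$ (a basis of the first) and $\mathcal{S}^{\circ}$. For $i\ge0$, $\pmb{\Lambda}_i=(\binom{k}{i})_{k\ge0}$ and $\widetilde{\pmb{\Lambda}}_i=(\binom{-k}{i})_{k\ge0}$ (integers viewed in $F$), and $\mathcal{T}=\{\pmb{\Lambda}_i:i\ge0\}$. $\mathcal{L}_q(F)$ is the set of sequences of $q\times q$ matrices over $F$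 satisfying a linear recurrence whose characteristic polynomial splits over $F$. Every $\pmb{U}\in\mathcal{L}_q(F)$ can be written uniquely (up to zero terms) as $$\pmb{U}=\mathcal{V}_0\pmb{0}_0+\cdots+\mathcal{V}_n\pmb{0}_n+\pmb{\mathcal{W}}_0\pmb{\Lambda}_0+\cdots+\pmb{\mathcal{W}}_m\pmb{\Lambda}_m,\qquad \mathcal{V}_i\in M_q(F),\ \pmb{\mathcal{W}}_i\in M_q(F_{\mathcal{S}^{\ast}}),$$ called the $\mathcal{P}$-canonical form of $\pmb{U}$ relative to $(\mathcal{S}^{\ast},\mathcal{T})$. If the characteristic polynomial of $A$ splits over $F$ then $\pmb{A}=(A^k)_{k\ge0}\in\mathcal{L}_q(F)$. $\theta:F_{\mathcal{S}^{\ast}}\to F_{\mathcal{S}^{\ast}}$ is the linear map with $\theta(\pmb{\lambda})=\pmb{\lambda}^{-1}=(\lambda^{-k})_{k\ge0}$, and $\widetilde{\theta}$ is its entrywise application to $M_q(F_{\mathcal{S}^{\ast}})$. The map $\widetilde{\theta}_0:\mathcal{L}_q(F)\to\mathcal{L}_q(F)$ sends $\pmb{U}$, with $\mathcal{P}$-canonical form $\pmb{U}=\mathcal{V}_0\pmb{0}_0+\cdots+\mathcal{V}_n\pmb{0}_n+\pmb{\mathcal{W}}_0\pmb{\Lambda}_0+\cdots+\pmb{\mathcal{W}}_m\pmb{\Lambda}_m$ relative to $(\mathcal{S}^{\ast},\mathcal{T})$ (where $\mathcal{V}_i\in M_q(F)$ and $\pmb{\mathcal{W}}_i\in M_q(F_{\mathcal{S}^{\ast}})$),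 to $$\widetilde{\theta}_0(\pmb{U})=\widetilde{\theta}(\pmb{\mathcal{W}}_0)\widetilde{\pmb{\Lambda}}_0+\cdots+\widetilde{\theta}(\pmb{\mathcal{W}}_m)\widetilde{\pmb{\Lambda}}_m$$ (i.e. the part with the $\pmb{0}_i$ is discarded and $-k$ is plugged in for $k$ in the rest). The index of $A$ is the smallest $t\ge0$ with $\operatorname{rank}A^{t}=\operatorname{rank}A^{t+1}$ (the multiplicity of $0$ as a root of the minimal polynomial). $\pi_0$ is the projection onto $\ker A^{t_0}$ along the sum of the generalized eigenspaces of $A$ at nonzero eigenvalues ($\pi_0=0$ if $A$ is nonsingular). The Drazin inverse $A_d$ is the unique matrix $B$ with $A^{k}BA=A^{k}$ for some $k\ge0$, $AB=BA$, $BAB=B$. *)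

theory Defs
  imports
    "HOL-Library.Function_Algebras"
    "Jordan_Normal_Form.DL_Rank"
    "Jordan_Normal_Form.Matrix_Kernel"
    "Jordan_Normal_Form.Char_Poly"
begin

section \<open>The algebra of scalar sequences\<close>

text \<open>
  The algebra of all scalar sequences over the field is the type \<open>nat \<Rightarrow> 'a\<close> with the
  pointwise operations of \<open>HOL-Library.Function_Algebras\<close>; in particular \<open>+\<close>, \<open>*\<close> and
  sums of sequences below are pointwise.
\<close>

definition const_seq :: "'a \<Rightarrow> nat \<Rightarrow> 'a" where
  "const_seq c = (\<lambda>k. c)"

definition seq_scale :: "'a::field \<Rightarrow> (nat \<Rightarrow> 'a) \<Rightarrow> nat \<Rightarrow> 'a" where
  "seq_scale c s = (\<lambda>k. c * s k)"

global_interpretation seq: Vector_Spaces.vector_space "seq_scale :: 'a::field \<Rightarrow> _"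
  by unfold_locales (auto simp: seq_scale_def fun_eq_iff algebra_simps)

global_interpretation seq_pair: vector_space_pair "seq_scale :: 'a::field \<Rightarrow> _" "seq_scale :: 'a \<Rightarrow> _"
  ..

definition pow_seq :: "'a::field \<Rightarrow> nat \<Rightarrow> 'a" where
  "pow_seq a = (\<lambda>k. a ^ k)"

definition S_star :: "(nat \<Rightarrow> 'a::field) set" where
  "S_star = pow_seq ` {a. a \<noteq> 0}"

definition F_S_star :: "(nat \<Rightarrow> 'a::field) set" where
  "F_S_star = seq.span S_star"

definition zero_seq :: "nat \<Rightarrow> nat \<Rightarrow> 'a::field" where
  "zero_seq i = (\<lambda>k. if k = i then 1 else 0)"

definition Lambda_seq :: "nat \<Rightarrow> nat \<Rightarrow> 'a::field" where
  "Lambda_seq i = (\<lambda>k. of_nat (k choose i))"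

text \<open>
  The binomial coefficient of an arbitrary integer, formed in the integers (the quotient is
  exact), so that it can be mapped to a field of any characteristic. The constant
  \<open>gchoose\<close> is restricted here to fields of characteristic 0.
\<close>

definition int_binomial :: "int \<Rightarrow> nat \<Rightarrow> int" where
  "int_binomial n i = (\<Prod>j = 0..<i. n - int j) div fact i"

lemma of_int_int_binomial:
  "(of_int (int_binomial n i) :: 'a::field_char_0) = of_int n gchoose i"
proof -
  have "fact i dvd (\<Prod>j = 0..<i. n - int j)"
    by (simp add: falling_fact_pochhammer' fact_dvd_pochhammer)
  then have "int_binomial n i * fact i = (\<Prod>j = 0..<i. n - int j)"
    unfolding int_binomial_def by (rule dvd_div_mult_self)
  then have "of_int (int_binomial n i * fact i) = (of_int (\<Prod>j = 0..<i. n - int j) :: 'a)"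
    by (rule arg_cong)
  then show ?thesis
    by (simp add: gbinomial_prod_rev eq_divide_eq)
qed

definition Lambda_tilde_seq :: "nat \<Rightarrow> nat \<Rightarrow> 'a::field" where
  "Lambda_tilde_seq i = (\<lambda>k. of_int (int_binomial (- int k) i))"

text \<open>
  The linear map determined on the basis \<^term>\<open>S_star\<close> of \<^term>\<open>F_S_star\<close> by
  \<open>(a\<^sup>k)\<^sub>k \<mapsto> (a\<^sup>-\<^sup>k)\<^sub>k\<close>. Outside \<^term>\<open>F_S_star\<close> its values are irrelevant.
\<close>

definition theta :: "(nat \<Rightarrow> 'a::field) \<Rightarrow> nat \<Rightarrow> 'a" where
  "theta = seq_pair.construct S_star (\<lambda>s k. inverse (s k))"

section \<open>Sequences of matrices\<close>

text \<open>
  A sequence of \<open>q \<times> q\<close> matrices is identified with a \<open>q \<times> q\<close> matrix whose entries are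
  scalar sequences. Under this identification the product of a matrix of sequences \<open>W\<close>
  with a scalar sequence \<open>s\<close> is the scalar multiple \<open>s \<cdot>\<^sub>m W\<close>.
\<close>

definition mat_of_seq :: "nat \<Rightarrow> (nat \<Rightarrow> 'a mat) \<Rightarrow> (nat \<Rightarrow> 'a) mat" where
  "mat_of_seq q U = mat q q (\<lambda>(i, j) k. U k $$ (i, j))"

definition mat_sum :: "nat \<Rightarrow> ('i \<Rightarrow> 'b::comm_monoid_add mat) \<Rightarrow> 'i set \<Rightarrow> 'b mat" where
  "mat_sum q M I = mat q q (\<lambda>(i, j). \<Sum>l\<in>I. M l $$ (i, j))"

definition splits :: "'a::field poly \<Rightarrow> bool" where
  "splits p \<longleftrightarrow> (\<exists>as. p = Polynomial.smult (lead_coeff p) (\<Prod>a\<leftarrow>as. [:- a, 1:]))"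

definition L_seqs :: "nat \<Rightarrow> (nat \<Rightarrow> 'a::field) mat set" where
  "L_seqs q = {U \<in> carrier_mat q q. \<exists>p. monic p \<and> splits p \<and>
     (\<forall>i<q. \<forall>j<q. \<forall>k. (\<Sum>l\<le>degree p. coeff p l * (U $$ (i, j)) (k + l)) = 0)}"

definition P_canonical_form ::
  "nat \<Rightarrow> (nat \<Rightarrow> 'a::field) mat \<Rightarrow> nat \<Rightarrow> (nat \<Rightarrow> 'a mat) \<Rightarrow> nat \<Rightarrow> (nat \<Rightarrow> (nat \<Rightarrow> 'a) mat) \<Rightarrow> bool"
where
  "P_canonical_form q U n V m W \<longleftrightarrow>
     (\<forall>l\<le>n. V l \<in> carrier_mat q q) \<and>
     (\<forall>l\<le>m. W l \<in> carrier_mat q q \<and> elements_mat (W l) \<subseteq> F_S_star) \<and>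
     U = mat_sum q (\<lambda>l. zero_seq l \<cdot>\<^sub>m map_mat const_seq (V l)) {..n}
       + mat_sum q (\<lambda>l. Lambda_seq l \<cdot>\<^sub>m W l) {..m}"

text \<open>
  The canonical form is unique only up to zero terms; the value below does not depend on
  them.
\<close>

definition theta0 :: "nat \<Rightarrow> (nat \<Rightarrow> 'a::field) mat \<Rightarrow> (nat \<Rightarrow> 'a) mat" where
  "theta0 q = (\<lambda>U\<in>L_seqs q. THE T. \<exists>n V m W. P_canonical_form q U n V m W \<and>
     T = mat_sum q (\<lambda>l. Lambda_tilde_seq l \<cdot>\<^sub>m map_mat theta (W l)) {..m})"

section \<open>Index, spectral projection and Drazin inverse\<close>

definition mat_index :: "nat \<Rightarrow> 'a::field mat \<Rightarrow> nat" where
  "mat_index q A = (LEAST t. vec_space.rank q (A ^\<^sub>m t) = vec_space.rank q (A ^\<^sub>m (t + 1)))"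

definition gen_eigenspace :: "'a::field mat \<Rightarrow> 'a \<Rightarrow> 'a vec set" where
  "gen_eigenspace A a = (\<Union>k. mat_kernel (char_matrix A a ^\<^sub>m k))"

definition nonzero_gen_eigenspaces :: "nat \<Rightarrow> 'a::field mat \<Rightarrow> 'a vec set" where
  "nonzero_gen_eigenspaces q A =
     LinearCombinations.module.span class_ring (module_vec TYPE('a) q)
       (\<Union>a\<in>{a. eigenvalue A a \<and> a \<noteq> 0}. gen_eigenspace A a)"

definition is_projection :: "nat \<Rightarrow> 'a::field vec set \<Rightarrow> 'a vec set \<Rightarrow> 'a mat \<Rightarrow> bool" where
  "is_projection q E E' P \<longleftrightarrow> P \<in> carrier_mat q q \<and> P * P = P \<and>
     (\<lambda>v. P *\<^sub>v v) ` carrier_vec q = E \<and> mat_kernel P = E'"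

text \<open>Here \<open>t\<close> is meant to be the index of \<open>A\<close>.\<close>

definition spectral_proj0 :: "nat \<Rightarrow> 'a::field mat \<Rightarrow> nat \<Rightarrow> 'a mat" where
  "spectral_proj0 q A t =
     (THE P. is_projection q (mat_kernel (A ^\<^sub>m t)) (nonzero_gen_eigenspaces q A) P)"

definition drazin_inverse :: "nat \<Rightarrow> 'a::field mat \<Rightarrow> 'a mat" where
  "drazin_inverse q A = (THE B. B \<in> carrier_mat q q \<and>
     (\<exists>k. A ^\<^sub>m k * B * A = A ^\<^sub>m k) \<and> A * B = B * A \<and> B * A * B = B)"

end

theory Submission
  imports Defs
begin

text \<open>
  Both sides of the identity are values, at negative integers, of sequences indexed by all
  integers. Write \<open>e\<close> for the projection onto the generalized kernel of \<open>A\<close> and put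
  \<open>E(k) = A\<^sup>k (1 - e)\<close> for \<open>k \<ge> 0\<close> and \<open>E(-k) = B\<^sup>k\<close> for \<open>k > 0\<close>, where \<open>B\<close> is the inverse of
  \<open>A\<close> on the image of \<open>1 - e\<close> and zero on the image of \<open>e\<close>; this \<open>B\<close> is the Drazin inverse.
  Then \<open>E(k + 1) = A E(k)\<close> for every integer \<open>k\<close>, so the entries of \<open>E\<close> satisfy a linear
  recurrence on the integers whose characteristic polynomial is the product \<open>r\<close> of the factors
  \<open>x - a\<close> of the characteristic polynomial with \<open>a \<noteq> 0\<close>.

  Such a bilateral sequence is a combination of the sequences \<open>(k choose i) a\<^sup>k\<close> with \<open>k\<close>
  ranging over the integers (\<open>recurrence_solution_in_exp_polys\<close>): one first order equation
  is solved at a time, with explicit particular solutions, in every characteristic. Replacing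
  \<open>k\<close> by \<open>-k\<close> in a canonical form means evaluating the bilateral extension of its part without
  the \<open>0\<^sub>i\<close> at \<open>-k\<close> (\<open>bilateral_neg\<close>). The result does not depend on the canonical form, since a
  bilateral solution of a recurrence with nonzero constant coefficient that vanishes for all
  large \<open>k\<close> is zero (\<open>exp_polys_eventually_zero\<close>). Since \<open>A\<^sup>k = E(k)\<close> for large \<open>k\<close>, the value
  of the reflection map at the power sequence of \<open>A\<close> is \<open>k \<mapsto> E(-k)\<close>
  (\<open>theta0_of_exp_polys\<close>), which is \<open>B\<^sup>k\<close> except that at \<open>k = 0\<close> it is \<open>1 - e\<close>.

  The matrices \<open>e\<close> and \<open>B\<close> are polynomials in \<open>A\<close>. By the Cayley-Hamilton theorem
  \<open>x\<^sup>N r\<close> annihilates \<open>A\<close> for some \<open>N > 0\<close>, and a Bezout identity \<open>x\<^sup>N u + r v = 1\<close> gives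
  \<open>e = (r v)(A)\<close>. All identities between these matrices are congruences modulo \<open>x\<^sup>N r\<close>.
\<close>

section \<open>Integer binomial coefficients and the map \<open>\<theta>\<close>\<close>

lemma sum_fun_apply: "(\<Sum>l\<in>I. f l) k = (\<Sum>l\<in>I. f l k)"
  by (induction I rule: infinite_finite_induct) auto

lemma int_binomial_of_nat: "int_binomial (int n) i = int (n choose i)"
proof -
  have "(of_int (int_binomial (int n) i) :: real) = of_int (int (n choose i))"
    unfolding of_int_int_binomial by (simp add: binomial_gbinomial)
  then show ?thesis by (simp only: of_int_eq_iff)
qed

lemma int_binomial_0 [simp]: "int_binomial k 0 = 1"
  by (simp add: int_binomial_def)

lemma int_binomial_Suc_Suc:
  "int_binomial (k + 1) (Suc i) = int_binomial k i + int_binomial k (Suc i)"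
proof -
  have "(of_int (int_binomial (k + 1) (Suc i)) :: real)
      = of_int (int_binomial k i + int_binomial k (Suc i))"
    by (simp add: of_int_int_binomial gbinomial_Suc_Suc)
  then show ?thesis by (simp only: of_int_eq_iff)
qed

text \<open>
  A relation between finitely many power sequences extends linearly to all polynomials evaluated
  at their bases; a polynomial vanishing at all bases but one isolates a coefficient.
\<close>

lemma independent_S_star: "seq.independent (S_star :: (nat \<Rightarrow> 'a::field) set)"
  unfolding seq.independent_explicit_finite_subsets
proof (intro allI impI ballI)
  fix T :: "(nat \<Rightarrow> 'a) set" and u s
  assume T: "T \<subseteq> S_star" and fin: "finite T" and z: "(\<Sum>v\<in>T. seq_scale (u v) v) = 0"
    and s: "s \<in> T"
  \<comment> \<open>The value at 1 recovers the base of a power sequence.\<close>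
  define R where "R = (\<lambda>v. v 1) ` (T - {s})"
  have pw: "v = pow_seq (v 1)" if "v \<in> T" for v
    using that T by (auto simp: S_star_def pow_seq_def)
  have "poly (\<Prod>b\<in>R. [:- b, 1:]) (s 1) \<noteq> 0"
  proof -
    have "s 1 \<notin> R" unfolding R_def using pw s by (auto simp del: One_nat_def) (metis One_nat_def)
    then show ?thesis using fin by (auto simp: poly_prod R_def)
  qed
  moreover define p where "p = (\<Prod>b\<in>R. [:- b, 1:])"
  ultimately have ps: "poly p (s 1) \<noteq> 0" by simp
  have pv: "poly p (v 1) = 0" if "v \<in> T - {s}" for v
  proof -
    have "v 1 \<in> R" "finite R" using that fin by (auto simp: R_def)
    then show ?thesis unfolding p_def poly_prod by (intro prod_zero) auto
  qed
  have zk: "(\<Sum>v\<in>T. u v * v 1 ^ k) = 0" for k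
  proof -
    have "(\<Sum>v\<in>T. u v * v 1 ^ k) = (\<Sum>v\<in>T. seq_scale (u v) v) k"
      unfolding sum_fun_apply seq_scale_def
      by (rule sum.cong) (simp, metis pw pow_seq_def)
    then show ?thesis using z by simp
  qed
  have "u s * poly p (s 1) = (\<Sum>v\<in>T. u v * poly p (v 1))"
    using s fin pv by (subst sum.remove[of T s]) auto
  also have "\<dots> = (\<Sum>v\<in>T. \<Sum>l\<le>degree p. coeff p l * (u v * v 1 ^ l))"
    by (simp add: poly_altdef sum_distrib_left mult_ac)
  also have "\<dots> = (\<Sum>l\<le>degree p. coeff p l * (\<Sum>v\<in>T. u v * v 1 ^ l))"
    by (subst sum.swap) (simp add: sum_distrib_left)
  also have "\<dots> = 0" by (simp only: zk) simp
  finally show "u s = 0" using ps by simp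
qed

interpretation theta: Vector_Spaces.linear seq_scale seq_scale
  "theta :: (nat \<Rightarrow> 'a::field) \<Rightarrow> _"
  unfolding theta_def by (rule seq_pair.linear_construct[OF independent_S_star])

lemma theta_pow_seq:
  assumes "a \<noteq> 0"
  shows "theta (pow_seq a) = (\<lambda>k. inverse a ^ k)"
proof -
  have "pow_seq a \<in> S_star" using assms by (auto simp: S_star_def)
  then show ?thesis unfolding theta_def
    by (subst seq_pair.construct_basis[OF independent_S_star])
      (auto simp: pow_seq_def power_inverse)
qed

section \<open>Bilateral sequences\<close>

text \<open>
  The extension of a sequence in \<^term>\<open>F_S_star\<close> to the integers: \<open>(a\<^sup>k)\<close> is continued to
  negative \<open>k\<close> by \<open>a powi k\<close>, linearly in the sequence. Outside \<^term>\<open>F_S_star\<close> the values at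
  negative integers have no meaning.
\<close>

definition ext_seq :: "(nat \<Rightarrow> 'a::field) \<Rightarrow> int \<Rightarrow> 'a" where
  "ext_seq w k = (if 0 \<le> k then w (nat k) else theta w (nat (- k)))"

lemma theta_zero [simp]: "theta (\<lambda>k. 0) = (\<lambda>k. 0)"
  using theta.zero by (simp add: zero_fun_def)

lemma ext_seq_zero [simp]: "ext_seq (\<lambda>k. 0) k = 0" "ext_seq 0 k = 0"
  by (simp_all add: ext_seq_def zero_fun_def)

lemma ext_seq_linear: "ext_seq (seq_scale c v + w) k = c * ext_seq v k + ext_seq w k"
  unfolding ext_seq_def theta.add theta.scale by (simp add: seq_scale_def)

lemma ext_seq_pow_seq: "a \<noteq> 0 \<Longrightarrow> ext_seq (pow_seq a) k = a powi k"
  by (simp add: ext_seq_def theta_pow_seq) (simp add: pow_seq_def power_int_def)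

lemma theta_at_0: "w \<in> F_S_star \<Longrightarrow> theta w 0 = w 0"
  unfolding F_S_star_def
proof (induction rule: seq.span_induct_alt)
  case base
  then show ?case by simp
next
  case (step c x y)
  then obtain a where "a \<noteq> 0" "x = pow_seq a" by (auto simp: S_star_def)
  then have "theta x 0 = x 0" by (simp add: theta_pow_seq) (simp add: pow_seq_def)
  then show ?case using step unfolding theta.add theta.scale by (simp add: seq_scale_def)
qed

lemma ext_seq_int: "ext_seq w (int k) = w k"
  by (simp add: ext_seq_def)

lemma ext_seq_neg: "w \<in> F_S_star \<Longrightarrow> ext_seq w (- int k) = theta w k"
  by (cases "k = 0") (auto simp: ext_seq_def theta_at_0)

text \<open>
  The part \<open>\<Sum>i\<le>m. W\<^sub>i \<Lambda>\<^sub>i\<close> of a scalar canonical form, continued to all integers. For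
  coefficients in \<^term>\<open>F_S_star\<close>, its values at nonpositive integers are those of the
  reflected sequence.
\<close>

definition bilateral :: "nat \<Rightarrow> (nat \<Rightarrow> nat \<Rightarrow> 'a::field) \<Rightarrow> int \<Rightarrow> 'a" where
  "bilateral m w k = (\<Sum>i\<le>m. of_int (int_binomial k i) * ext_seq (w i) k)"

lemma bilateral_int: "bilateral m w (int k) = (\<Sum>i\<le>m. Lambda_seq i k * w i k)"
  by (simp add: bilateral_def Lambda_seq_def int_binomial_of_nat ext_seq_int)

lemma bilateral_neg:
  assumes "\<And>i. w i \<in> F_S_star"
  shows "bilateral m w (- int k) = (\<Sum>i\<le>m. Lambda_tilde_seq i k * theta (w i) k)"
  by (simp add: bilateral_def Lambda_tilde_seq_def ext_seq_neg assms)

lemma bilateral_mono: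
  assumes "m \<le> m'" "\<And>i. i > m \<Longrightarrow> w i = 0"
  shows "bilateral m' w = bilateral m w"
proof
  fix k
  show "bilateral m' w k = bilateral m w k" unfolding bilateral_def
    by (rule sum.mono_neutral_right) (use assms in auto)
qed

text \<open>
  The linear span of the bilateral sequences \<open>(k choose i) a\<^sup>k\<close> with \<open>a \<noteq> 0\<close>. These are exactly the
  sequences \<^term>\<open>bilateral m w\<close> with coefficients \<open>w i\<close> in \<^term>\<open>F_S_star\<close>.
\<close>

inductive_set exp_polys :: "(int \<Rightarrow> 'a::field) set" where
  zero: "(\<lambda>k. 0) \<in> exp_polys"
| step: "f \<in> exp_polys \<Longrightarrow> a \<noteq> 0 \<Longrightarrow>
    (\<lambda>k. c * (of_int (int_binomial k i) * a powi k) + f k) \<in> exp_polys"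

lemma exp_polys_add:
  assumes "f \<in> exp_polys" "g \<in> exp_polys"
  shows "(\<lambda>k. f k + g k) \<in> exp_polys"
  using assms(1)
proof induction
  case zero
  then show ?case using assms(2) by simp
next
  case (step f a c i)
  then show ?case using exp_polys.step[OF step(3,2), of c i] by (simp add: add.assoc)
qed

lemma exp_polys_scale:
  assumes "f \<in> exp_polys"
  shows "(\<lambda>k. c * f k) \<in> exp_polys"
  using assms
proof induction
  case zero
  then show ?case using exp_polys.zero by simp
next
  case (step f a d i)
  then show ?case using exp_polys.step[OF step(3,2), of "c * d" i]
    by (simp add: algebra_simps)
qed

lemma exp_polys_basic:
  "a \<noteq> 0 \<Longrightarrow> (\<lambda>k. of_int (int_binomial k i) * a powi k) \<in> exp_polys"
  using exp_polys.step[OF exp_polys.zero, of a 1 i] by simp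

lemma exp_polys_diff:
  assumes "f \<in> exp_polys" "g \<in> exp_polys"
  shows "(\<lambda>k. f k - g k) \<in> exp_polys"
  using exp_polys_add[OF assms(1) exp_polys_scale[OF assms(2), of "-1"]] by simp

lemma exp_polys_sum:
  assumes "\<And>i. i \<in> I \<Longrightarrow> f i \<in> exp_polys"
  shows "(\<lambda>k. \<Sum>i\<in>I. f i k) \<in> exp_polys"
  using assms
  by (induction I rule: infinite_finite_induct)
    (auto intro: exp_polys.zero exp_polys_add)

lemma bilateral_in_exp_polys:
  assumes "\<And>i. w i \<in> F_S_star"
  shows "bilateral m w \<in> exp_polys"
proof -
  have "(\<lambda>k. of_int (int_binomial k i) * ext_seq v k) \<in> exp_polys"
    if "v \<in> F_S_star" for v :: "nat \<Rightarrow> 'a" and i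
    using that unfolding F_S_star_def
  proof (induction rule: seq.span_induct_alt)
    case base
    show ?case using exp_polys.zero by simp
  next
    case (step c x y)
    then obtain a where "a \<noteq> 0" "x = pow_seq a" by (auto simp: S_star_def)
    then show ?case using exp_polys.step[OF step(2), of a c i]
      unfolding ext_seq_linear by (simp add: ext_seq_pow_seq algebra_simps)
  qed
  then have "(\<lambda>k. \<Sum>i\<le>m. of_int (int_binomial k i) * ext_seq (w i) k) \<in> exp_polys"
    by (intro exp_polys_sum) (use assms in auto)
  then show ?thesis by (simp add: bilateral_def[abs_def])
qed

lemma exp_polys_imp_bilateral:
  assumes "f \<in> exp_polys"
  shows "\<exists>m w. (\<forall>i. w i \<in> F_S_star) \<and> (\<forall>i>m. w i = 0) \<and> f = bilateral m w"
  using assms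
proof induction
  case zero
  show ?case
    by (rule exI[of _ 0], rule exI[of _ "\<lambda>_. 0"])
      (auto simp: bilateral_def F_S_star_def seq.span_zero[unfolded zero_fun_def])
next
  case (step f a c i)
  then obtain m w where w: "\<And>i. w i \<in> F_S_star" "\<And>i. i > m \<Longrightarrow> w i = 0" "f = bilateral m w"
    by metis
  define m' where "m' = max m i"
  define w' where "w' = w(i := seq_scale c (pow_seq a) + w i)"
  have "pow_seq a \<in> F_S_star" using step(2)
    by (auto simp: F_S_star_def S_star_def intro: seq.span_base)
  then have "\<forall>i. w' i \<in> F_S_star" using w(1)
    by (auto simp: w'_def F_S_star_def intro: seq.span_add seq.span_scale)
  moreover have "\<forall>i>m'. w' i = 0" using w(2) by (auto simp: w'_def m'_def)
  moreover have "bilateral m' w' k = c * (of_int (int_binomial k i) * a powi k) + f k" for k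
  proof -
    have "of_int (int_binomial k j) * ext_seq (w' j) k
        = (if j = i then of_int (int_binomial k j) * (c * a powi k) else 0)
          + of_int (int_binomial k j) * ext_seq (w j) k" for j
      by (auto simp: w'_def ext_seq_linear ext_seq_pow_seq step(2) distrib_left mult_ac)
    then have "bilateral m' w' k
      = (\<Sum>j\<le>m'. if j = i then of_int (int_binomial k j) * (c * a powi k) else 0) + bilateral m' w k"
      by (simp only: bilateral_def sum.distrib)
    also have "bilateral m' w = f"
      using bilateral_mono[of m m' w] w by (simp add: m'_def)
    finally show ?thesis by (simp add: m'_def)
  qed
  ultimately show ?case by (intro exI[of _ m'] exI[of _ w']) auto
qed

section \<open>Recurrences on the integers\<close>

text \<open>
  The action of a polynomial on bilateral sequences in which \<open>x\<close> acts as the shift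
  \<open>f \<mapsto> (k \<mapsto> f (k + 1))\<close>.
\<close>

definition shift_poly :: "'a::field poly \<Rightarrow> (int \<Rightarrow> 'a) \<Rightarrow> int \<Rightarrow> 'a" where
  "shift_poly p f k = (\<Sum>l\<le>degree p. coeff p l * f (k + int l))"

lemma sum_coeff_pCons:
  fixes g :: "nat \<Rightarrow> 'a::comm_ring_1"
  shows "(\<Sum>l\<le>degree (pCons a p). coeff (pCons a p) l * g l)
    = a * g 0 + (\<Sum>l\<le>degree p. coeff p l * g (Suc l))"
proof -
  have "(\<Sum>l\<le>degree (pCons a p). coeff (pCons a p) l * g l)
      = (\<Sum>l\<le>Suc (degree p). coeff (pCons a p) l * g l)"
    by (rule sum.mono_neutral_left) (auto simp: degree_pCons_le coeff_eq_0)
  also have "\<dots> = a * g 0 + (\<Sum>l\<le>degree p. coeff p l * g (Suc l))"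
    by (subst sum.atMost_Suc_shift) simp
  finally show ?thesis .
qed

lemma shift_poly_0 [simp]: "shift_poly 0 f k = 0"
  by (simp add: shift_poly_def)

lemma shift_poly_pCons: "shift_poly (pCons a p) f k = a * f k + shift_poly p f (k + 1)"
  unfolding shift_poly_def sum_coeff_pCons by (simp add: add_ac)

lemma shift_poly_1 [simp]: "shift_poly 1 f = f"
  by (simp add: one_pCons shift_poly_pCons fun_eq_iff)

lemma shift_poly_linear: "shift_poly [:- a, 1:] f k = f (k + 1) - a * f k"
  by (simp add: shift_poly_pCons)

lemma shift_poly_combine:
  "shift_poly p (\<lambda>k. c * f k + g k) k = c * shift_poly p f k + shift_poly p g k"
  by (simp add: shift_poly_def sum.distrib sum_distrib_left algebra_simps)

lemma shift_poly_zero_fun [simp]: "shift_poly p (\<lambda>k. 0) k = 0"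
  by (simp add: shift_poly_def)

lemma shift_poly_add_left: "shift_poly (p + q) f k = shift_poly p f k + shift_poly q f k"
  by (induction p q arbitrary: k rule: poly_induct2) (simp_all add: shift_poly_pCons algebra_simps)

lemma shift_poly_smult_left: "shift_poly (Polynomial.smult c p) f k = c * shift_poly p f k"
  by (induction p arbitrary: k) (simp_all add: shift_poly_pCons algebra_simps)

lemma shift_poly_mult: "shift_poly (p * q) f k = shift_poly p (shift_poly q f) k"
  by (induction p arbitrary: k)
    (simp_all add: shift_poly_pCons shift_poly_add_left shift_poly_smult_left)

lemma shift_poly_kills_basic:
  fixes a :: "'a::field"
  assumes "a \<noteq> 0"
  shows "shift_poly ([:- a, 1:] ^ Suc i) (\<lambda>k. of_int (int_binomial k i) * a powi k) k = 0"
proof (induction i arbitrary: k)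
  case 0
  then show ?case using assms by (simp add: shift_poly_linear power_int_add)
next
  case (Suc i)
  have "shift_poly [:- a, 1:] (\<lambda>k. of_int (int_binomial k (Suc i)) * a powi k)
      = (\<lambda>k. a * (of_int (int_binomial k i) * a powi k) + 0)"
    using assms by (auto simp: shift_poly_linear power_int_add int_binomial_Suc_Suc algebra_simps)
  then show ?case unfolding power_Suc2[of _ "Suc i"] shift_poly_mult
    by (simp only: shift_poly_combine Suc) simp
qed

lemma exp_polys_annihilated:
  assumes "f \<in> exp_polys"
  shows "\<exists>p. coeff p 0 \<noteq> 0 \<and> shift_poly p f = (\<lambda>k. 0)"
  using assms
proof induction
  case zero
  show ?case by (rule exI[of _ 1]) auto
next
  case (step f a c i)
  then obtain p where p: "coeff p 0 \<noteq> 0" "shift_poly p f = (\<lambda>k. 0)" by auto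
  let ?q = "[:- a, 1:] ^ Suc i"
  have "shift_poly ?q (\<lambda>k. of_int (int_binomial k i) * a powi k) = (\<lambda>k. 0)"
    using shift_poly_kills_basic[OF step(2)] by blast
  then have 1: "shift_poly (p * ?q) (\<lambda>k. of_int (int_binomial k i) * a powi k) k = 0" for k
    by (simp only: shift_poly_mult shift_poly_zero_fun)
  have 2: "shift_poly (p * ?q) f k = 0" for k
    unfolding mult.commute[of p] shift_poly_mult p(2) by simp
  have "shift_poly (p * ?q) (\<lambda>k. c * (of_int (int_binomial k i) * a powi k) + f k) = (\<lambda>k. 0)"
    by (rule ext) (simp only: shift_poly_combine 1 2, simp)
  moreover have "coeff (p * ?q) 0 \<noteq> 0"
    using p(1) step(2) unfolding poly_0_coeff_0[symmetric] by (simp add: poly_power)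
  ultimately show ?case by blast
qed

text \<open>
  A recurrence with nonzero constant coefficient determines each value from the later ones.
\<close>

lemma annihilated_eventually_zero:
  assumes p: "coeff p 0 \<noteq> 0" "shift_poly p f = (\<lambda>k. 0)" and z: "\<And>k. k \<ge> N \<Longrightarrow> f k = 0"
  shows "f k = 0"
proof -
  have "\<forall>k \<ge> N - int d. f k = 0" for d
  proof (induction d)
    case 0
    then show ?case using z by simp
  next
    case (Suc d)
    show ?case
    proof (intro allI impI)
      fix k assume k: "k \<ge> N - int (Suc d)"
      have "0 = shift_poly p f k" using p(2) by simp
      also have "\<dots> = coeff p 0 * f k + (\<Sum>l\<in>{..degree p} - {0}. coeff p l * f (k + int l))"
        unfolding shift_poly_def by (subst sum.remove[of _ 0]) auto
      also have "(\<Sum>l\<in>{..degree p} - {0}. coeff p l * f (k + int l)) = 0"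
        by (rule sum.neutral) (use k Suc in auto)
      finally show "f k = 0" using p(1) by simp
    qed
  qed
  from this[of "nat (N - k)"] show ?thesis by auto
qed

lemma exp_polys_eventually_zero:
  assumes "f \<in> exp_polys" "\<And>k. k \<ge> N \<Longrightarrow> f k = 0"
  shows "f k = 0"
  using exp_polys_annihilated[OF assms(1)] annihilated_eventually_zero assms(2) by metis

lemma exp_polys_particular_basic:
  fixes a b :: "'a::field"
  assumes "a \<noteq> 0" "b \<noteq> 0"
  shows "\<exists>h\<in>exp_polys. shift_poly [:- a, 1:] h = (\<lambda>k. of_int (int_binomial k i) * b powi k)"
proof (cases "a = b")
  case True
  \<comment> \<open>At a root of the operator the binomial index goes up by one.\<close>
  have "shift_poly [:- a, 1:] (\<lambda>k. inverse a * (of_int (int_binomial k (Suc i)) * a powi k))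
      = (\<lambda>k. of_int (int_binomial k i) * b powi k)"
    using assms True
    by (auto simp: shift_poly_linear power_int_add int_binomial_Suc_Suc field_simps)
  then show ?thesis using exp_polys_scale[OF exp_polys_basic[OF assms(1)]] by blast
next
  case False
  show ?thesis
  proof (induction i)
    case 0
    have "shift_poly [:- a, 1:] (\<lambda>k. inverse (b - a) * (of_int (int_binomial k 0) * b powi k))
      = (\<lambda>k. of_int (int_binomial k 0) * b powi k)"
      using assms False by (auto simp: shift_poly_linear power_int_add divide_simps fun_eq_iff)
        (simp add: algebra_simps)
    then show ?case using exp_polys_scale[OF exp_polys_basic[OF assms(2)]] by blast
  next
    case (Suc i)
    then obtain h where h: "h \<in> exp_polys"
      "shift_poly [:- a, 1:] h = (\<lambda>k. of_int (int_binomial k i) * b powi k)" by blast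
    let ?e = "\<lambda>k. of_int (int_binomial k (Suc i)) * b powi k"
    let ?g = "\<lambda>k. inverse (b - a) * (?e k - b * h k)"
    have "h (k + 1) = of_int (int_binomial k i) * b powi k + a * h k" for k
      using fun_cong[OF h(2), of k] by (simp add: shift_poly_linear algebra_simps)
    then have "shift_poly [:- a, 1:] ?g k = ?e k" for k
      using assms False
      by (simp add: shift_poly_linear power_int_add divide_simps int_binomial_Suc_Suc)
        (simp add: algebra_simps)
    moreover have "?g \<in> exp_polys"
      by (intro exp_polys_scale exp_polys_diff exp_polys_basic h assms)
    ultimately show ?case by blast
  qed
qed

lemma exp_polys_particular:
  assumes "g \<in> exp_polys" and a: "a \<noteq> 0"
  shows "\<exists>h\<in>exp_polys. shift_poly [:- a, 1:] h = g"
  using assms(1)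
proof induction
  case zero
  show ?case by (rule bexI[OF _ exp_polys.zero]) auto
next
  case (step f b c i)
  obtain h where h: "h \<in> exp_polys" "shift_poly [:- a, 1:] h = f" using step by blast
  obtain h' where h': "h' \<in> exp_polys"
    "shift_poly [:- a, 1:] h' = (\<lambda>k. of_int (int_binomial k i) * b powi k)"
    using exp_polys_particular_basic[OF a step(2)] by blast
  have "(\<lambda>k. c * h' k + h k) \<in> exp_polys" by (intro exp_polys_add exp_polys_scale h h')
  moreover have "shift_poly [:- a, 1:] (\<lambda>k. c * h' k + h k)
      = (\<lambda>k. c * (of_int (int_binomial k i) * b powi k) + f k)"
    by (rule ext) (simp only: shift_poly_combine h h')
  ultimately show ?case by blast
qed

text \<open>
  Induction on the roots: splitting off the factor \<open>x - a\<close>, a solution differs from a particular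
  solution in \<^term>\<open>exp_polys\<close> by a multiple of \<open>a\<^sup>k\<close>.
\<close>

lemma recurrence_solution_in_exp_polys:
  assumes "0 \<notin> set as" "shift_poly (\<Prod>a\<leftarrow>as. [:- a, 1:]) f = (\<lambda>k. 0)"
  shows "f \<in> exp_polys"
  using assms
proof (induction as arbitrary: f)
  case Nil
  then show ?case using exp_polys.zero by simp
next
  case (Cons a as)
  let ?g = "shift_poly [:- a, 1:] f"
  have a: "a \<noteq> 0" using Cons.prems by auto
  have "shift_poly (\<Prod>a\<leftarrow>as. [:- a, 1:]) ?g k = shift_poly (\<Prod>a\<leftarrow>a # as. [:- a, 1:]) f k" for k
    unfolding shift_poly_mult[symmetric] by (simp add: mult.commute del: mult_pCons_left mult_pCons_right)
  then have "shift_poly (\<Prod>a\<leftarrow>as. [:- a, 1:]) ?g = (\<lambda>k. 0)"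
    using Cons.prems(2) by auto
  then have "?g \<in> exp_polys" using Cons by auto
  then obtain h where h: "h \<in> exp_polys" "shift_poly [:- a, 1:] h = ?g"
    using exp_polys_particular a by blast
  define d where "d k = f k - h k" for k
  have d: "d (k + 1) = a * d k" for k
    using fun_cong[OF h(2), of k] by (simp add: d_def shift_poly_linear algebra_simps)
  have "d k = d 0 * a powi k" for k
  proof (induction k rule: int_induct[where k = 0])
    case (step2 i)
    then show ?case using d[of "i - 1"] a by (simp add: power_int_diff field_simps)
  qed (use d a in \<open>auto simp: power_int_add\<close>)
  then have "f = (\<lambda>k. d 0 * (of_int (int_binomial k 0) * a powi k) + h k)"
    by (auto simp: d_def algebra_simps fun_eq_iff)
  then show ?case using exp_polys.step[OF h(1) a, of "d 0" 0] by simp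
qed

section \<open>The reflection map on canonical forms\<close>

text \<open>
  Beyond the range of the \<open>0\<^sub>l\<close>, each entry of a canonical form is a bilateral sequence at
  nonnegative integers, and the entry of its reflection is the same sequence at the negatives.
\<close>

lemma canonical_form_entry:
  assumes C: "P_canonical_form q U n V m W" and ij: "i < q" "j < q"
  obtains w where "\<And>l. w l \<in> F_S_star" and "\<And>l. l > m \<Longrightarrow> w l = 0"
    and "\<And>k. k > n \<Longrightarrow> (U $$ (i, j)) k = bilateral m w (int k)"
    and "\<And>k. (mat_sum q (\<lambda>l. Lambda_tilde_seq l \<cdot>\<^sub>m map_mat theta (W l)) {..m} $$ (i, j)) k
      = bilateral m w (- int k)"
proof
  let ?w = "\<lambda>l. if l \<le> m then W l $$ (i, j) else 0"
  have V: "V l \<in> carrier_mat q q" if "l \<le> n" for l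
    using C that by (auto simp: P_canonical_form_def)
  have W: "W l \<in> carrier_mat q q" "elements_mat (W l) \<subseteq> F_S_star" if "l \<le> m" for l
    using C that by (auto simp: P_canonical_form_def)
  have dims: "l \<le> n \<Longrightarrow> dim_row (V l) = q" "l \<le> n \<Longrightarrow> dim_col (V l) = q"
    "l \<le> m \<Longrightarrow> dim_row (W l) = q" "l \<le> m \<Longrightarrow> dim_col (W l) = q" for l
    using V[of l] W(1)[of l] by auto
  have z: "0 \<in> F_S_star" by (simp add: F_S_star_def seq.span_zero)
  show F: "?w l \<in> F_S_star" for l
    using W[of l] elements_matI[OF W(1) ij refl] z by auto
  show "?w l = 0" if "l > m" for l using that by simp
  have "U = mat_sum q (\<lambda>l. zero_seq l \<cdot>\<^sub>m map_mat const_seq (V l)) {..n}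
       + mat_sum q (\<lambda>l. Lambda_seq l \<cdot>\<^sub>m W l) {..m}"
    using C by (auto simp: P_canonical_form_def)
  then have U: "(U $$ (i, j)) k = (\<Sum>l\<le>n. (zero_seq l \<cdot>\<^sub>m map_mat const_seq (V l)) $$ (i, j)) k
      + (\<Sum>l\<le>m. (Lambda_seq l \<cdot>\<^sub>m W l) $$ (i, j)) k" for k
    using ij by (simp add: mat_sum_def)
  show "(U $$ (i, j)) k = bilateral m ?w (int k)" if k: "k > n" for k
  proof -
    have "(\<Sum>l\<le>n. (zero_seq l \<cdot>\<^sub>m map_mat const_seq (V l)) $$ (i, j)) k = 0"
      unfolding sum_fun_apply
      by (rule sum.neutral) (use ij k in \<open>auto simp: dims zero_seq_def\<close>)
    moreover have "(\<Sum>l\<le>m. (Lambda_seq l \<cdot>\<^sub>m W l) $$ (i, j)) k = bilateral m ?w (int k)"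
      unfolding sum_fun_apply bilateral_int
      by (rule sum.cong) (use ij in \<open>auto simp: dims\<close>)
    ultimately show ?thesis unfolding U by simp
  qed
  show "(mat_sum q (\<lambda>l. Lambda_tilde_seq l \<cdot>\<^sub>m map_mat theta (W l)) {..m} $$ (i, j)) k
      = bilateral m ?w (- int k)" for k
  proof -
    have "(mat_sum q (\<lambda>l. Lambda_tilde_seq l \<cdot>\<^sub>m map_mat theta (W l)) {..m} $$ (i, j)) k
      = (\<Sum>l\<le>m. (Lambda_tilde_seq l \<cdot>\<^sub>m map_mat theta (W l)) $$ (i, j)) k"
      using ij by (simp add: mat_sum_def)
    also have "\<dots> = bilateral m ?w (- int k)"
      unfolding sum_fun_apply bilateral_neg[OF F]
      by (rule sum.cong) (use ij in \<open>auto simp: dims\<close>)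
    finally show ?thesis .
  qed
qed

lemma canonical_value_unique:
  assumes C: "P_canonical_form q U n V m W" and C': "P_canonical_form q U n' V' m' W'"
  shows "mat_sum q (\<lambda>l. Lambda_tilde_seq l \<cdot>\<^sub>m map_mat theta (W l)) {..m}
    = mat_sum q (\<lambda>l. Lambda_tilde_seq l \<cdot>\<^sub>m map_mat theta (W' l)) {..m'}" (is "?T = ?T'")
proof (rule eq_matI)
  fix i j assume "i < dim_row ?T'" "j < dim_col ?T'"
  then have ij: "i < q" "j < q" by (auto simp: mat_sum_def)
  obtain w where w: "\<And>l. w l \<in> F_S_star" "\<And>l. l > m \<Longrightarrow> w l = 0"
    "\<And>k. k > n \<Longrightarrow> (U $$ (i, j)) k = bilateral m w (int k)"
    "\<And>k. (?T $$ (i, j)) k = bilateral m w (- int k)"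
    by (rule canonical_form_entry[OF C ij]) (rule that)
  obtain w' where w': "\<And>l. w' l \<in> F_S_star" "\<And>l. l > m' \<Longrightarrow> w' l = 0"
    "\<And>k. k > n' \<Longrightarrow> (U $$ (i, j)) k = bilateral m' w' (int k)"
    "\<And>k. (?T' $$ (i, j)) k = bilateral m' w' (- int k)"
    by (rule canonical_form_entry[OF C' ij]) (rule that)
  let ?d = "\<lambda>k. bilateral m w k - bilateral m' w' k"
  have d: "?d \<in> exp_polys"
    by (intro exp_polys_diff bilateral_in_exp_polys w w')
  have "?d k = 0" if "k \<ge> int (Suc (max n n'))" for k
  proof -
    have "nat k > n" "nat k > n'" "int (nat k) = k" using that by auto
    then show ?thesis using w(3)[of "nat k"] w'(3)[of "nat k"] by simp
  qed
  then have "?d k = 0" for k by (rule exp_polys_eventually_zero[OF d])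
  then show "?T $$ (i, j) = ?T' $$ (i, j)"
    by (intro ext) (simp add: w(4) w'(4))
qed (auto simp: mat_sum_def)

lemma theta0_eq:
  assumes "U \<in> L_seqs q" "P_canonical_form q U n V m W"
  shows "theta0 q U = mat_sum q (\<lambda>l. Lambda_tilde_seq l \<cdot>\<^sub>m map_mat theta (W l)) {..m}"
proof -
  have "(THE T. \<exists>n V m W. P_canonical_form q U n V m W \<and>
     T = mat_sum q (\<lambda>l. Lambda_tilde_seq l \<cdot>\<^sub>m map_mat theta (W l)) {..m})
    = mat_sum q (\<lambda>l. Lambda_tilde_seq l \<cdot>\<^sub>m map_mat theta (W l)) {..m}"
  proof (rule the_equality)
    show "\<exists>n V m' W'. P_canonical_form q U n V m' W' \<and>
      mat_sum q (\<lambda>l. Lambda_tilde_seq l \<cdot>\<^sub>m map_mat theta (W l)) {..m}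
        = mat_sum q (\<lambda>l. Lambda_tilde_seq l \<cdot>\<^sub>m map_mat theta (W' l)) {..m'}"
      by (intro exI conjI, rule assms(2), rule refl)
  qed (elim exE conjE, simp only: canonical_value_unique[OF _ assms(2)])
  then show ?thesis using assms(1) by (simp add: theta0_def)
qed

text \<open>
  If the entries of \<open>U\<close> eventually agree with bilateral sequences in \<^term>\<open>exp_polys\<close>, then the
  reflection map sends \<open>U\<close> to the values of these at nonpositive integers.
\<close>

lemma theta0_of_exp_polys:
  fixes E :: "nat \<Rightarrow> nat \<Rightarrow> int \<Rightarrow> 'a::field"
  assumes UL: "U \<in> L_seqs q"
    and E: "\<And>i j. i < q \<Longrightarrow> j < q \<Longrightarrow> E i j \<in> exp_polys"
    and U: "\<And>i j k. i < q \<Longrightarrow> j < q \<Longrightarrow> k > n \<Longrightarrow> (U $$ (i, j)) k = E i j (int k)"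
  shows "theta0 q U = mat q q (\<lambda>(i, j) k. E i j (- int k))"
proof -
  have Uc: "U \<in> carrier_mat q q" using UL by (simp add: L_seqs_def)
  have "\<forall>i j. \<exists>m w. i < q \<longrightarrow> j < q \<longrightarrow>
      (\<forall>l. w l \<in> F_S_star) \<and> (\<forall>l>m. w l = 0) \<and> E i j = bilateral m w"
    using exp_polys_imp_bilateral[OF E] by blast
  then obtain M w where w: "\<And>i j l. i < q \<Longrightarrow> j < q \<Longrightarrow> w i j l \<in> F_S_star"
    "\<And>i j l. i < q \<Longrightarrow> j < q \<Longrightarrow> l > M i j \<Longrightarrow> w i j l = 0"
    "\<And>i j. i < q \<Longrightarrow> j < q \<Longrightarrow> E i j = bilateral (M i j) (w i j)"
    by metis
  define m where "m = (\<Sum>i<q. \<Sum>j<q. M i j)"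
  have Mm: "M i j \<le> m" if "i < q" "j < q" for i j
  proof -
    have "M i j \<le> (\<Sum>j<q. M i j)" by (rule member_le_sum) (use that in auto)
    also have "\<dots> \<le> m" unfolding m_def
      by (rule member_le_sum[where f = "\<lambda>i. \<Sum>j<q. M i j"]) (use that in auto)
    finally show ?thesis .
  qed
  have Eb: "E i j = bilateral m (w i j)" if "i < q" "j < q" for i j
    unfolding w(3)[OF that] by (rule bilateral_mono[OF Mm w(2), symmetric]) (use that in auto)
  define W where "W l = mat q q (\<lambda>(i, j). w i j l)" for l
  \<comment> \<open>The terms with \<open>0\<^sub>l\<close> correct the finitely many entries where \<open>U\<close> and \<open>E\<close> differ.\<close>
  define V where "V l = mat q q (\<lambda>(i, j). (U $$ (i, j)) l - E i j (int l))" for l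
  have el: "elements_mat (W l) \<subseteq> F_S_star" for l
  proof
    fix x assume "x \<in> elements_mat (W l)"
    then obtain i j where "i < q" "j < q" "x = W l $$ (i, j)" by (auto simp: W_def)
    then show "x \<in> F_S_star" using w(1) by (simp add: W_def)
  qed
  have "P_canonical_form q U n V m W"
    unfolding P_canonical_form_def
  proof (intro conjI allI impI)
    show "V l \<in> carrier_mat q q" for l by (simp add: V_def)
    show "W l \<in> carrier_mat q q" for l by (simp add: W_def)
    show "elements_mat (W l) \<subseteq> F_S_star" for l by (rule el)
    let ?S = "mat_sum q (\<lambda>l. zero_seq l \<cdot>\<^sub>m map_mat const_seq (V l)) {..n}
       + mat_sum q (\<lambda>l. Lambda_seq l \<cdot>\<^sub>m W l) {..m}"
    show "U = ?S"
    proof (rule eq_matI)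
      fix i j assume "i < dim_row ?S" "j < dim_col ?S"
      then have ij: "i < q" "j < q" by (auto simp: mat_sum_def)
      have "(U $$ (i, j)) k = (?S $$ (i, j)) k" for k
      proof -
        have "(?S $$ (i, j)) k = (\<Sum>l\<le>n. (zero_seq l \<cdot>\<^sub>m map_mat const_seq (V l)) $$ (i, j)) k
            + (\<Sum>l\<le>m. (Lambda_seq l \<cdot>\<^sub>m W l) $$ (i, j)) k"
          using ij by (simp add: mat_sum_def)
        also have "(\<Sum>l\<le>m. (Lambda_seq l \<cdot>\<^sub>m W l) $$ (i, j)) k = E i j (int k)"
          unfolding sum_fun_apply Eb[OF ij] bilateral_int
          by (rule sum.cong) (use ij in \<open>auto simp: W_def\<close>)
        also have "(\<Sum>l\<le>n. (zero_seq l \<cdot>\<^sub>m map_mat const_seq (V l)) $$ (i, j)) k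
            = (\<Sum>l\<le>n. if l = k then (U $$ (i, j)) k - E i j (int k) else 0)"
          unfolding sum_fun_apply
          by (rule sum.cong) (use ij in \<open>auto simp: V_def zero_seq_def const_seq_def\<close>)
        also have "\<dots> = (U $$ (i, j)) k - E i j (int k)"
          using U[OF ij, of k] by (cases "k \<le> n") auto
        finally show ?thesis by simp
      qed
      then show "U $$ (i, j) = ?S $$ (i, j)" by blast
    qed (use Uc in \<open>auto simp: mat_sum_def\<close>)
  qed
  note th = theta0_eq[OF UL this]
  show ?thesis unfolding th
  proof (rule eq_matI)
    fix i j assume "i < dim_row (mat q q (\<lambda>(i, j) k. E i j (- int k)))"
      "j < dim_col (mat q q (\<lambda>(i, j) k. E i j (- int k)))"
    then have ij: "i < q" "j < q" by auto
    have "(\<Sum>l\<le>m. (Lambda_tilde_seq l \<cdot>\<^sub>m map_mat theta (W l)) $$ (i, j)) k = E i j (- int k)" for k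
      unfolding sum_fun_apply Eb[OF ij] bilateral_neg[OF w(1)[OF ij]]
      by (rule sum.cong) (use ij in \<open>auto simp: W_def\<close>)
    then show "mat_sum q (\<lambda>l. Lambda_tilde_seq l \<cdot>\<^sub>m map_mat theta (W l)) {..m} $$ (i, j)
        = mat q q (\<lambda>(i, j) k. E i j (- int k)) $$ (i, j)"
      using ij by (auto simp: mat_sum_def)
  qed (auto simp: mat_sum_def)
qed

section \<open>Polynomials in a matrix\<close>

text \<open>
  The value \<open>p(A)\<close> of a polynomial at an \<open>n \<times> n\<close> matrix, given entrywise; the dimension is a
  parameter.
\<close>

definition mat_poly :: "nat \<Rightarrow> 'a::field mat \<Rightarrow> 'a poly \<Rightarrow> 'a mat" where
  "mat_poly n A p = mat n n (\<lambda>(i, j). \<Sum>l\<le>degree p. coeff p l * (A ^\<^sub>m l) $$ (i, j))"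

lemma pow_mat_Suc_left:
  assumes "A \<in> carrier_mat n n"
  shows "A ^\<^sub>m Suc k = A * A ^\<^sub>m k"
proof (induction k)
  case (Suc k)
  then show ?case using assms by (simp add: assoc_mult_mat[of _ n n _ n _ n])
qed (use assms in auto)

lemma mult_entry:
  assumes "X \<in> carrier_mat n n" "Y \<in> carrier_mat n n" "i < n" "j < n"
  shows "(X * Y) $$ (i, j) = (\<Sum>k<n. X $$ (i, k) * Y $$ (k, j))"
  using assms by (auto simp: scalar_prod_def lessThan_atLeast0 intro!: sum.cong)

context
  fixes A :: "'a::field mat" and n :: nat
  assumes A: "A \<in> carrier_mat n n"
begin

lemma mat_poly_carrier [simp]: "mat_poly n A p \<in> carrier_mat n n"
  by (simp add: mat_poly_def)

lemma mat_poly_dim [simp]: "dim_row (mat_poly n A p) = n" "dim_col (mat_poly n A p) = n"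
  by (simp_all add: mat_poly_def)

lemma mat_poly_0 [simp]: "mat_poly n A 0 = 0\<^sub>m n n"
  by (auto simp: mat_poly_def)

lemma mat_poly_mult_entry:
  assumes "M \<in> carrier_mat n n" "i < n" "j < n"
  shows "(mat_poly n A p * M) $$ (i, j) = (\<Sum>l\<le>degree p. coeff p l * (A ^\<^sub>m l * M) $$ (i, j))"
proof -
  have "(mat_poly n A p * M) $$ (i, j)
      = (\<Sum>k<n. (\<Sum>l\<le>degree p. coeff p l * (A ^\<^sub>m l) $$ (i, k)) * M $$ (k, j))"
    using assms by (subst mult_entry[of _ n]) (auto simp: mat_poly_def)
  also have "\<dots> = (\<Sum>l\<le>degree p. coeff p l * (\<Sum>k<n. (A ^\<^sub>m l) $$ (i, k) * M $$ (k, j)))"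
    unfolding sum_distrib_right sum_distrib_left by (subst sum.swap) (simp add: mult_ac)
  also have "\<dots> = (\<Sum>l\<le>degree p. coeff p l * (A ^\<^sub>m l * M) $$ (i, j))"
    by (rule sum.cong) (use assms A in \<open>auto simp: mult_entry[of _ n] simp del: index_mult_mat\<close>)
  finally show ?thesis .
qed

lemma mat_poly_pCons: "mat_poly n A (pCons a p) = a \<cdot>\<^sub>m 1\<^sub>m n + A * mat_poly n A p"
proof (rule eq_matI)
  fix i j assume "i < dim_row (a \<cdot>\<^sub>m 1\<^sub>m n + A * mat_poly n A p)"
    "j < dim_col (a \<cdot>\<^sub>m 1\<^sub>m n + A * mat_poly n A p)"
  then have ij: "i < n" "j < n" using A by auto
  have "(A * mat_poly n A p) $$ (i, j)
      = (\<Sum>k<n. A $$ (i, k) * (\<Sum>l\<le>degree p. coeff p l * (A ^\<^sub>m l) $$ (k, j)))"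
    using ij A by (subst mult_entry[of _ n]) (auto simp: mat_poly_def)
  also have "\<dots> = (\<Sum>l\<le>degree p. coeff p l * (\<Sum>k<n. A $$ (i, k) * (A ^\<^sub>m l) $$ (k, j)))"
    unfolding sum_distrib_left by (subst sum.swap) (simp add: mult_ac)
  also have "\<dots> = (\<Sum>l\<le>degree p. coeff p l * (A ^\<^sub>m Suc l) $$ (i, j))"
    by (rule sum.cong)
      (use ij A in \<open>auto simp: mult_entry[of _ n] pow_mat_Suc_left[OF A]
         simp del: index_mult_mat pow_mat.simps\<close>)
  finally have "(A * mat_poly n A p) $$ (i, j)
      = (\<Sum>l\<le>degree p. coeff p l * (A ^\<^sub>m Suc l) $$ (i, j))" .
  moreover have "mat_poly n A (pCons a p) $$ (i, j)
      = a * (1\<^sub>m n) $$ (i, j) + (\<Sum>l\<le>degree p. coeff p l * (A ^\<^sub>m Suc l) $$ (i, j))"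
    using sum_coeff_pCons[of a p "\<lambda>l. (A ^\<^sub>m l) $$ (i, j)"] ij A by (simp add: mat_poly_def)
  ultimately show "mat_poly n A (pCons a p) $$ (i, j)
      = (a \<cdot>\<^sub>m 1\<^sub>m n + A * mat_poly n A p) $$ (i, j)"
    using ij A by (simp del: index_mult_mat(1))
qed (use A in auto)

lemma mat_poly_1 [simp]: "mat_poly n A 1 = 1\<^sub>m n"
  using A by (auto simp: one_pCons mat_poly_pCons)

lemma mat_poly_X [simp]: "mat_poly n A [:0, 1:] = A"
  using A by (auto simp: mat_poly_pCons intro!: eq_matI)

lemma mat_poly_linear: "mat_poly n A [:- a, 1:] = char_matrix A a"
  using A by (auto simp: mat_poly_pCons char_matrix_def intro!: eq_matI)

lemma mat_poly_add: "mat_poly n A (p + q) = mat_poly n A p + mat_poly n A q"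
proof (induction p q rule: poly_induct2)
  case (pCons a p b q)
  have "a \<cdot>\<^sub>m 1\<^sub>m n + b \<cdot>\<^sub>m 1\<^sub>m n + (A * mat_poly n A p + A * mat_poly n A q)
     = a \<cdot>\<^sub>m 1\<^sub>m n + A * mat_poly n A p + (b \<cdot>\<^sub>m 1\<^sub>m n + A * mat_poly n A q)"
    by (rule eq_matI) (use A in \<open>auto simp del: index_mult_mat(1)\<close>)
  then show ?case using pCons A
    by (simp add: mat_poly_pCons mult_add_distrib_mat[of _ n n _ n] add_smult_distrib_right_mat[of _ n n])
qed auto

lemma mat_poly_smult: "mat_poly n A (Polynomial.smult c p) = c \<cdot>\<^sub>m mat_poly n A p"
  by (rule eq_matI) (auto simp: mat_poly_def sum_distrib_left mult.assoc)

lemma mat_poly_mult: "mat_poly n A (p * q) = mat_poly n A p * mat_poly n A q"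
proof (induction p)
  case (pCons a p)
  have "mat_poly n A (pCons a p) * mat_poly n A q
      = a \<cdot>\<^sub>m mat_poly n A q + A * (mat_poly n A p * mat_poly n A q)"
    using A by (simp add: mat_poly_pCons add_mult_distrib_mat[of _ n n _ _ n]
        mult_smult_assoc_mat[of _ n n _ n] assoc_mult_mat[of _ n n _ n _ n])
  moreover have "mat_poly n A (pCons a p * q)
      = a \<cdot>\<^sub>m mat_poly n A q + A * mat_poly n A (p * q)"
  proof -
    have "0 \<cdot>\<^sub>m 1\<^sub>m n + A * mat_poly n A (p * q) = A * mat_poly n A (p * q)"
      by (rule eq_matI) (use A in auto)
    then show ?thesis
      by (simp add: mat_poly_add mat_poly_smult mat_poly_pCons)
  qed
  ultimately show ?case using pCons by simp
qed auto

lemma mat_poly_power: "mat_poly n A (p ^ k) = mat_poly n A p ^\<^sub>m k"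
proof (induction k)
  case (Suc k)
  then show ?case unfolding power_Suc2 mat_poly_mult by simp
qed auto

lemma mat_poly_cong:
  assumes "mat_poly n A m = 0\<^sub>m n n" "m dvd p - q"
  shows "mat_poly n A p = mat_poly n A q"
proof -
  obtain c where "p - q = m * c" using assms(2) by (auto simp: dvd_def)
  then have "p = m * c + q" by (simp add: algebra_simps)
  then show ?thesis
    by (simp add: mat_poly_add mat_poly_mult assms(1) left_mult_zero_mat[of _ n n] left_add_zero_mat[of _ n n])
qed

lemma mat_poly_commute: "mat_poly n A p * mat_poly n A q = mat_poly n A q * mat_poly n A p"
  unfolding mat_poly_mult[symmetric] by (simp add: mult.commute)

text \<open>
  The Cayley-Hamilton theorem. Comparing coefficients in \<open>(x - A) adj(x - A) = \<chi> 1\<close> gives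
  \<open>c\<^sub>l 1 = D\<^sub>l\<^sub>-\<^sub>1 - A D\<^sub>l\<close>, where \<open>c\<^sub>l\<close> and \<open>D\<^sub>l\<close> (\<open>B l\<close> in the proof) are the coefficients
  of \<open>\<chi>\<close> and of the adjugate, and
  the sum of \<open>c\<^sub>l A\<^sup>l\<close> telescopes.
\<close>

lemma mat_poly_char_poly: "mat_poly n A (char_poly A) = 0\<^sub>m n n"
proof -
  define D where "D = adj_mat (char_poly_matrix A)"
  have D: "D \<in> carrier_mat n n" "char_poly_matrix A * D = char_poly A \<cdot>\<^sub>m 1\<^sub>m n"
    using adj_mat[of "char_poly_matrix A" n] A by (auto simp: D_def char_poly_def)
  define B where "B l = map_mat (\<lambda>p. coeff p l) D" for l
  have B: "B l \<in> carrier_mat n n" for l using D by (simp add: B_def)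
  define c where "c l = coeff (char_poly A) l" for l
  have eq: "c l * (1\<^sub>m n) $$ (i, j) = (if l = 0 then 0 else B (l - 1) $$ (i, j)) - (A * B l) $$ (i, j)"
    if ij: "i < n" "j < n" for i j l
  proof -
    have 1: "(char_poly_matrix A * D) $$ (i, j)
       = (\<Sum>k<n. char_poly_matrix A $$ (i, k) * D $$ (k, j))"
      by (rule mult_entry) (use A D ij in auto)
    have 2: "char_poly_matrix A $$ (i, k) * D $$ (k, j)
       = (if k = i then pCons 0 (D $$ (i, j)) else 0) - Polynomial.smult (A $$ (i, k)) (D $$ (k, j))"
      if "k < n" for k
      using that ij A by (auto simp: char_poly_matrix_def)
    have "coeff ((char_poly A \<cdot>\<^sub>m 1\<^sub>m n) $$ (i, j)) l
      = coeff (\<Sum>k<n. (if k = i then pCons 0 (D $$ (i, j)) else 0)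
           - Polynomial.smult (A $$ (i, k)) (D $$ (k, j))) l"
      using 1 2 unfolding D(2) by (metis (no_types, lifting) lessThan_iff sum.cong)
    also have "\<dots> = coeff (pCons 0 (D $$ (i, j))) l - (\<Sum>k<n. A $$ (i, k) * coeff (D $$ (k, j)) l)"
      using ij by (simp add: sum_subtractf coeff_sum)
    also have "(\<Sum>k<n. A $$ (i, k) * coeff (D $$ (k, j)) l) = (A * B l) $$ (i, j)"
      using A B D ij by (subst mult_entry[of _ n]) (auto simp: B_def)
    also have "coeff (pCons 0 (D $$ (i, j))) l = (if l = 0 then 0 else B (l - 1) $$ (i, j))"
      using D ij by (auto simp: B_def coeff_pCons split: nat.split)
    finally show ?thesis using ij by (cases "i = j") (simp_all add: c_def)
  qed
  have tele: "(\<Sum>l\<le>N. c l * (A ^\<^sub>m l) $$ (i, j)) = - (A ^\<^sub>m Suc N * B N) $$ (i, j)"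
    if ij: "i < n" "j < n" for i j N
  proof (induction N)
    case 0
    then show ?case using eq[OF ij, of 0] A by simp
  next
    case (Suc N)
    have "c (Suc N) \<cdot>\<^sub>m 1\<^sub>m n = B N - A * B (Suc N)"
    proof (rule eq_matI)
      fix i j assume "i < dim_row (B N - A * B (Suc N))" "j < dim_col (B N - A * B (Suc N))"
      then have ij: "i < n" "j < n" using A B[of "Suc N"] by auto
      then show "(c (Suc N) \<cdot>\<^sub>m 1\<^sub>m n) $$ (i, j) = (B N - A * B (Suc N)) $$ (i, j)"
        using eq[OF ij, of "Suc N"] A B[of N] B[of "Suc N"] by (simp del: index_mult_mat(1))
    qed (use A B[of "Suc N"] in auto)
    then have "A ^\<^sub>m Suc N * (c (Suc N) \<cdot>\<^sub>m 1\<^sub>m n)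
        = A ^\<^sub>m Suc N * B N - A ^\<^sub>m Suc N * (A * B (Suc N))"
      using A B by (simp add: mult_minus_distrib_mat[of _ n n _ n] del: pow_mat.simps)
    also have "A ^\<^sub>m Suc N * (A * B (Suc N)) = A ^\<^sub>m Suc (Suc N) * B (Suc N)"
      using A B by (simp add: assoc_mult_mat[of _ n n _ n _ n])
    finally have "c (Suc N) \<cdot>\<^sub>m A ^\<^sub>m Suc N
        = A ^\<^sub>m Suc N * B N - A ^\<^sub>m Suc (Suc N) * B (Suc N)"
      using A by (simp add: mult_smult_distrib[of _ n n _ n] right_mult_one_mat[of _ n n] del: pow_mat.simps)
    then have "(c (Suc N) \<cdot>\<^sub>m A ^\<^sub>m Suc N) $$ (i, j)
        = (A ^\<^sub>m Suc N * B N - A ^\<^sub>m Suc (Suc N) * B (Suc N)) $$ (i, j)"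
      by simp
    then have "c (Suc N) * (A ^\<^sub>m Suc N) $$ (i, j)
        = (A ^\<^sub>m Suc N * B N) $$ (i, j) - (A ^\<^sub>m Suc (Suc N) * B (Suc N)) $$ (i, j)"
      using ij A B[of N] B[of "Suc N"] by (simp del: pow_mat.simps index_mult_mat(1))
    then show ?case using Suc by (simp del: pow_mat.simps index_mult_mat(1))
  qed
  \<comment> \<open>\<open>N\<close> exceeds the degree of every entry of the adjugate, so \<open>B N\<close> is zero.\<close>
  define N where "N = degree (char_poly A) + (\<Sum>i<n. \<Sum>j<n. Suc (degree (D $$ (i, j))))"
  have BN: "B N = 0\<^sub>m n n"
  proof (rule eq_matI)
    fix i j assume "i < dim_row (0\<^sub>m n n)" "j < dim_col (0\<^sub>m n n)"
    then have ij: "i < n" "j < n" by auto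
    have "Suc (degree (D $$ (i, j))) \<le> (\<Sum>j<n. Suc (degree (D $$ (i, j))))"
      by (rule member_le_sum[where f = "\<lambda>j. Suc (degree (D $$ (i, j)))"]) (use ij in auto)
    also have "\<dots> \<le> (\<Sum>i<n. \<Sum>j<n. Suc (degree (D $$ (i, j))))"
      by (rule member_le_sum[where f = "\<lambda>i. \<Sum>j<n. Suc (degree (D $$ (i, j)))"]) (use ij in auto)
    finally show "B N $$ (i, j) = 0\<^sub>m n n $$ (i, j)"
      using ij D by (auto simp: B_def N_def intro!: coeff_eq_0)
  qed (use D in \<open>auto simp: B_def\<close>)
  show ?thesis
  proof (rule eq_matI)
    fix i j assume "i < dim_row (0\<^sub>m n n)" "j < dim_col (0\<^sub>m n n)"
    then have ij: "i < n" "j < n" by auto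
    have "mat_poly n A (char_poly A) $$ (i, j) = (\<Sum>l\<le>degree (char_poly A). c l * (A ^\<^sub>m l) $$ (i, j))"
      using ij by (simp add: mat_poly_def c_def)
    also have "\<dots> = (\<Sum>l\<le>N. c l * (A ^\<^sub>m l) $$ (i, j))"
      by (rule sum.mono_neutral_left) (auto simp: N_def c_def coeff_eq_0)
    also have "\<dots> = 0" unfolding tele[OF ij] BN using A ij by simp
    finally show "mat_poly n A (char_poly A) $$ (i, j) = 0\<^sub>m n n $$ (i, j)" using ij by simp
  qed auto
qed

end

text \<open>
  The field is not assumed to carry a gcd operation, so coprimality is expressed by the Bezout
  identity. Here \<open>(x - a) w = 1 - p c\<close> for some \<open>w\<close> and a constant \<open>c\<close>, and \<open>(1 - p c)\<^sup>k\<close> is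
  congruent to 1 modulo \<open>p\<close>.
\<close>

lemma linear_power_bezout:
  fixes p :: "'a::field poly"
  assumes "poly p a \<noteq> 0"
  obtains u v where "[:- a, 1:] ^ k * u + p * v = 1"
proof -
  have "[:- a, 1:] dvd p - [:poly p a:]" by (simp add: poly_eq_0_iff_dvd[symmetric])
  then obtain d where d: "p - [:poly p a:] = [:- a, 1:] * d" by (auto simp: dvd_def)
  define c where "c = [:inverse (poly p a):]"
  have pc: "[:poly p a:] * c = 1" using assms by (simp add: c_def one_pCons)
  have e: "[:- a, 1:] * (- d * c) = 1 - p * c"
  proof -
    have "[:- a, 1:] * (- d * c) = - ([:- a, 1:] * d) * c" by (simp only: mult_minus_left mult_minus_right mult.assoc)
    also have "\<dots> = [:poly p a:] * c - p * c"
      unfolding d[symmetric] by (simp only: minus_diff_eq left_diff_distrib)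
    finally show ?thesis by (simp only: pc)
  qed
  have "p dvd 1 - (1 - p * c) ^ k"
  proof -
    have "1 - (1 - p * c) ^ k = p * c * (\<Sum>i<k. (1 - p * c) ^ i)"
      by (subst one_diff_power_eq) simp
    then show ?thesis by (simp only: mult.assoc dvd_triv_left)
  qed
  then obtain v where "1 - (1 - p * c) ^ k = p * v" by (auto simp: dvd_def)
  then have "[:- a, 1:] ^ k * (- d * c) ^ k + p * v = 1"
    unfolding power_mult_distrib[symmetric] e by (simp add: algebra_simps)
  then show ?thesis using that by blast
qed

section \<open>Rank, projections and uniqueness of the Drazin inverse\<close>

lemma (in vectorspace) subspace_full_dim:
  assumes "VectorSpace.subspace K X V" "fin_dim" "vectorspace.fin_dim K (vs X)"
    and "vectorspace.dim K (vs X) = dim"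
  shows "X = carrier V"
proof -
  have vX: "vectorspace K (vs X)" using assms(1) subspace_is_vs by auto
  then obtain b where fb: "finite b" and b: "vectorspace.basis K (vs X) b"
    using vectorspace.finite_basis_exists assms(3) by blast
  have sub: "submodule K X V" using assms(1) by (simp add: subspace_def)
  have bX: "b \<subseteq> X" using b vectorspace.basis_def[OF vX] by auto
  have XV: "X \<subseteq> carrier V" using sub by (auto simp: submodule_def)
  have li: "lin_indpt b"
    using b vectorspace.basis_def[OF vX] span_li_not_depend(2)[OF bX sub] by auto
  have "card b = dim" using vectorspace.dim_basis[OF vX fb b] assms(4) by simp
  then have "basis b" by (intro dim_li_is_basis) (use assms fb bX XV li in auto)
  then have "carrier V = span b" by (simp add: basis_def)
  also have "\<dots> \<subseteq> X" by (rule span_is_subset[OF bX sub])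
  finally show ?thesis using XV by auto
qed

lemma col_space_image:
  fixes M :: "'a::field mat"
  assumes "M \<in> carrier_mat q q"
  shows "LinearCombinations.module.span class_ring (module_vec TYPE('a) q) (set (cols M))
    = (\<lambda>x. M *\<^sub>v x) ` carrier_vec q"
proof -
  interpret vec_space "TYPE('a)" q .
  show ?thesis using col_space_eq[OF assms] assms by (auto simp: col_space_def)
qed

text \<open>
  Equal ranks force the column spaces of \<open>A\<^sup>t\<close> and \<open>A\<^sup>t\<^sup>+\<^sup>1\<close> to coincide, so each column of
  \<open>A\<^sup>t\<close> is the image of a vector under \<open>A\<^sup>t\<^sup>+\<^sup>1\<close>.
\<close>

lemma rank_pow_eq_imp_factor:
  fixes A :: "'a::field mat"
  assumes A: "A \<in> carrier_mat q q"
    and r: "vec_space.rank q (A ^\<^sub>m t) = vec_space.rank q (A ^\<^sub>m (t + 1))"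
  shows "\<exists>X\<in>carrier_mat q q. A ^\<^sub>m t = A ^\<^sub>m (t + 1) * X"
proof -
  interpret vec_space "TYPE('a)" q .
  let ?W = "span (set (cols (A ^\<^sub>m t)))" and ?X = "span (set (cols (A ^\<^sub>m (t + 1))))"
  note cs = col_space_image
  have At: "A ^\<^sub>m k \<in> carrier_mat q q" for k using A by simp
  have sub: "?X \<subseteq> ?W"
    unfolding cs[OF At] using A by (auto simp: assoc_mult_mat_vec[of _ q q])
  have ss: "VectorSpace.subspace class_ring (span (set (cols (A ^\<^sub>m k)))) V" for k
    using span_is_subspace cols_dim[of "A ^\<^sub>m k"] A by simp
  have fd: "vectorspace.fin_dim class_ring (span_vs (set (cols (A ^\<^sub>m k))))" for k
    by (rule fin_dim_span_cols[OF At])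
  interpret W: vectorspace class_ring "vs ?W" by (rule subspace_is_vs[OF ss])
  have "?X = carrier (vs ?W)"
    by (rule W.subspace_full_dim) (use nested_subspaces[OF ss ss sub] fd[of t] fd[of "t + 1"] r in \<open>simp_all add: rank_def del: pow_mat.simps\<close>)
  then have eq: "?W = ?X" by simp
  have "\<forall>j<q. \<exists>x\<in>carrier_vec q. A ^\<^sub>m (t + 1) *\<^sub>v x = col (A ^\<^sub>m t) j"
  proof (intro allI impI)
    fix j assume "j < q"
    then have "col (A ^\<^sub>m t) j \<in> (\<lambda>x. A ^\<^sub>m t *\<^sub>v x) ` carrier_vec q"
      using col_mult2[OF At[of t], of "1\<^sub>m q" q j] right_mult_one_mat[OF At[of t]]
      by (auto intro!: image_eqI[of _ _ "unit_vec q j"])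
    then have "col (A ^\<^sub>m t) j \<in> (\<lambda>x. A ^\<^sub>m (t + 1) *\<^sub>v x) ` carrier_vec q"
      using eq unfolding cs[OF At] by (simp only:)
    then show "\<exists>x\<in>carrier_vec q. A ^\<^sub>m (t + 1) *\<^sub>v x = col (A ^\<^sub>m t) j"
      by (elim imageE) (metis (no_types))
  qed
  then obtain x where x: "\<And>j. j < q \<Longrightarrow> x j \<in> carrier_vec q \<and> A ^\<^sub>m (t + 1) *\<^sub>v x j = col (A ^\<^sub>m t) j"
    by metis
  let ?M = "mat q q (\<lambda>(i, j). x j $ i)"
  have "A ^\<^sub>m t = A ^\<^sub>m (t + 1) * ?M"
  proof (rule mat_col_eqI)
    fix j assume "j < dim_col (A ^\<^sub>m (t + 1) * ?M)"
    then have j: "j < q" by simp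
    have "col ?M j = x j" by (rule eq_vecI) (use j x[OF j] in auto)
    then show "col (A ^\<^sub>m t) j = col (A ^\<^sub>m (t + 1) * ?M) j"
      using col_mult2[OF At[of "t + 1"], of ?M q j] j x by simp
  qed (use A in auto)
  then show ?thesis by (intro bexI[of _ ?M]) auto
qed

text \<open>
  Both \<open>b\<close> and \<open>d\<close> equal \<open>d a b\<close>, because \<open>b = a\<^sup>j b\<^sup>j\<^sup>+\<^sup>1\<close> and \<open>d = d\<^sup>j\<^sup>+\<^sup>1 a\<^sup>j\<close> for every \<open>j\<close>.
\<close>

lemma (in monoid) drazin_inverse_unique:
  fixes k l :: nat
  assumes c [simp]: "a \<in> carrier G" "b \<in> carrier G" "d \<in> carrier G"
    and b: "a [^] k \<otimes> b \<otimes> a = a [^] k" "a \<otimes> b = b \<otimes> a" "b \<otimes> a \<otimes> b = b"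
    and d: "a [^] l \<otimes> d \<otimes> a = a [^] l" "a \<otimes> d = d \<otimes> a" "d \<otimes> a \<otimes> d = d"
  shows "b = d"
proof -
  have pb: "b = a [^] j \<otimes> b [^] Suc j" for j :: nat
  proof (induction j)
    case (Suc j)
    have "b = a \<otimes> b \<otimes> b" using b by simp
    also have "\<dots> = a \<otimes> (a [^] j \<otimes> b [^] Suc j) \<otimes> b" using Suc by simp
    also have "\<dots> = (a \<otimes> a [^] j) \<otimes> (b [^] Suc j \<otimes> b)"
      by (simp add: m_assoc del: nat_pow_Suc)
    also have "\<dots> = a [^] Suc j \<otimes> b [^] Suc (Suc j)"
      unfolding nat_pow_Suc2[OF c(1), symmetric] by simp
    finally show ?case .
  qed simp
  have pd: "d = d [^] Suc j \<otimes> a [^] j" for j :: nat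
  proof (induction j)
    case (Suc j)
    have "d = d \<otimes> (d \<otimes> a)" using d by (simp add: m_assoc)
    also have "\<dots> = d \<otimes> ((d [^] Suc j \<otimes> a [^] j) \<otimes> a)" using Suc by simp
    also have "\<dots> = d [^] Suc (Suc j) \<otimes> a [^] Suc j"
      using nat_pow_Suc2[of d "Suc j"] by (simp add: m_assoc)
    finally show ?case .
  qed simp
  have "d \<otimes> a \<otimes> b = d \<otimes> a \<otimes> (a [^] l \<otimes> b [^] Suc l)" using pb by simp
  also have "\<dots> = (d \<otimes> a \<otimes> a [^] l) \<otimes> b [^] Suc l" by (simp add: m_assoc del: nat_pow_Suc)
  also have "d \<otimes> a \<otimes> a [^] l = a [^] l \<otimes> (d \<otimes> a)"
    by (rule group_commutes_pow[symmetric]) (use d(2) in \<open>simp_all add: m_assoc[symmetric]\<close>)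
  also have "\<dots> \<otimes> b [^] Suc l = b" using d(1) pb[of l] by (simp add: m_assoc del: nat_pow_Suc)
  finally have 1: "d \<otimes> a \<otimes> b = b" .
  have "d \<otimes> a \<otimes> b = (d [^] Suc k \<otimes> a [^] k) \<otimes> (b \<otimes> a)"
    using pd[of k] b(2) by (simp add: m_assoc del: nat_pow_Suc)
  also have "\<dots> = d [^] Suc k \<otimes> (a [^] k \<otimes> b \<otimes> a)" by (simp add: m_assoc del: nat_pow_Suc)
  also have "\<dots> = d" using b(1) pd[of k] by simp
  finally show ?thesis using 1 by simp
qed

lemma rank_eq_if_factors:
  fixes M N :: "'a::field mat"
  assumes c: "M \<in> carrier_mat q q" "N \<in> carrier_mat q q" "Y \<in> carrier_mat q q" "Z \<in> carrier_mat q q"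
    and M: "M = N * Y" and N: "N = M * Z"
  shows "vec_space.rank q M = vec_space.rank q N"
proof -
  have "(\<lambda>x. M *\<^sub>v x) ` carrier_vec q \<subseteq> (\<lambda>x. N *\<^sub>v x) ` carrier_vec q"
    by (subst M) (use c in \<open>auto simp: assoc_mult_mat_vec[of _ q q]\<close>)
  moreover have "(\<lambda>x. N *\<^sub>v x) ` carrier_vec q \<subseteq> (\<lambda>x. M *\<^sub>v x) ` carrier_vec q"
    by (subst N) (use c in \<open>auto simp: assoc_mult_mat_vec[of _ q q]\<close>)
  ultimately have "(\<lambda>x. M *\<^sub>v x) ` carrier_vec q = (\<lambda>x. N *\<^sub>v x) ` carrier_vec q" by blast
  then show ?thesis
    unfolding vec_space.rank_def col_space_image[OF c(1)] col_space_image[OF c(2)] by simp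
qed

lemma mat_eq_if_mult_vec_eq:
  fixes M N :: "'a::field mat"
  assumes c: "M \<in> carrier_mat q q" "N \<in> carrier_mat q q"
    and e: "\<And>x. x \<in> carrier_vec q \<Longrightarrow> M *\<^sub>v x = N *\<^sub>v x"
  shows "M = N"
proof (rule mat_col_eqI)
  fix j assume "j < dim_col N"
  then have j: "j < q" using c by simp
  have "col M j = M *\<^sub>v unit_vec q j" "col N j = N *\<^sub>v unit_vec q j"
    using col_mult2[OF c(1), of "1\<^sub>m q" q j] col_mult2[OF c(2), of "1\<^sub>m q" q j]
      right_mult_one_mat[OF c(1)] right_mult_one_mat[OF c(2)] j by simp_all
  then show "col M j = col N j" using e by simp
qed (use c in auto)

lemma is_projection_unique:
  fixes P :: "'a::field mat"
  assumes P: "is_projection q E E' P" and P': "is_projection q E E' P'"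
  shows "P = P'"
proof (rule mat_eq_if_mult_vec_eq)
  show c: "P \<in> carrier_mat q q" "P' \<in> carrier_mat q q"
    using P P' by (auto simp: is_projection_def)
  fix x :: "'a vec" assume x: "x \<in> carrier_vec q"
  have Px: "P *\<^sub>v x \<in> carrier_vec q" "P' *\<^sub>v x \<in> carrier_vec q" using c x by auto
  have "P *\<^sub>v x \<in> E" using P x by (auto simp: is_projection_def)
  then obtain y where y: "y \<in> carrier_vec q" "P *\<^sub>v x = P' *\<^sub>v y"
    using P' by (auto simp: is_projection_def)
  have "P' *\<^sub>v (P' *\<^sub>v y) = (P' * P') *\<^sub>v y" using c y by simp
  also have "\<dots> = P' *\<^sub>v y" using P' by (simp add: is_projection_def)
  finally have 1: "P' *\<^sub>v (P *\<^sub>v x) = P *\<^sub>v x" using y by simp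
  have "P *\<^sub>v (P *\<^sub>v x) = (P * P) *\<^sub>v x" using c x by simp
  also have "\<dots> = P *\<^sub>v x" using P by (simp add: is_projection_def)
  finally have "P *\<^sub>v (x - P *\<^sub>v x) = 0\<^sub>v q"
    using mult_minus_distrib_mat_vec[OF c(1) x Px(1)] Px by simp
  then have "x - P *\<^sub>v x \<in> mat_kernel P"
    using mat_kernelI[OF c(1)] x Px by simp
  then have "x - P *\<^sub>v x \<in> mat_kernel P'" using P P' by (simp add: is_projection_def)
  then have "P' *\<^sub>v x - P' *\<^sub>v (P *\<^sub>v x) = 0\<^sub>v q"
    using mat_kernelD[OF c(2)] mult_minus_distrib_mat_vec[OF c(2) x Px(1)] by simp
  then have z: "P' *\<^sub>v x - P *\<^sub>v x = 0\<^sub>v q" by (simp only: 1)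
  show "P *\<^sub>v x = P' *\<^sub>v x"
  proof (rule eq_vecI)
    fix i assume "i < dim_vec (P' *\<^sub>v x)"
    then have i: "i < q" using c by simp
    have "(P' *\<^sub>v x - P *\<^sub>v x) $ i = 0" using z i by simp
    moreover have "(P' *\<^sub>v x - P *\<^sub>v x) $ i = (P' *\<^sub>v x) $ i - (P *\<^sub>v x) $ i"
      by (rule index_minus_vec(1)) (use i c in auto)
    ultimately show "(P *\<^sub>v x) $ i = (P' *\<^sub>v x) $ i" by (simp only: right_minus_eq)
  qed (use c in auto)
qed

lemma drazin_inverse_eqI:
  fixes A :: "'a::field mat"
  assumes A: "A \<in> carrier_mat q q" and B: "B \<in> carrier_mat q q"
    and "A ^\<^sub>m k * B * A = A ^\<^sub>m k" "A * B = B * A" "B * A * B = B"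
  shows "drazin_inverse q A = B"
  unfolding drazin_inverse_def
proof (rule the_equality)
  show "B \<in> carrier_mat q q \<and> (\<exists>k. A ^\<^sub>m k * B * A = A ^\<^sub>m k) \<and> A * B = B * A \<and> B * A * B = B"
    using assms by blast
  interpret R: ring "ring_mat TYPE('a) q ()" by (rule ring_mat)
  fix C assume C: "C \<in> carrier_mat q q \<and> (\<exists>k. A ^\<^sub>m k * C * A = A ^\<^sub>m k) \<and> A * C = C * A \<and> C * A * C = C"
  then obtain l where l: "A ^\<^sub>m l * C * A = A ^\<^sub>m l" by blast
  show "C = B"
    by (rule R.drazin_inverse_unique[of A C B l k, unfolded ring_mat_simps pow_mat_ring_pow[OF A, symmetric]])
      (use assms C l in auto)
qed

section \<open>The Fitting decomposition by polynomials in the matrix\<close>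

lemma poly_prod_linear_eq_0_iff:
  "poly (\<Prod>b\<leftarrow>bs. [:- b, 1:]) a = 0 \<longleftrightarrow> a \<in> set (bs :: 'a::field list)"
  by (induction bs) auto

lemma prod_linear_split:
  "(\<Prod>b\<leftarrow>bs. [:- b, 1:]) = [:- a, 1:] ^ count_list bs a
    * (\<Prod>b\<leftarrow>filter (\<lambda>b. b \<noteq> a) bs. [:- b, 1 :: 'a::field:])"
  by (induction bs) (auto simp del: mult_pCons_left mult_pCons_right simp: mult_ac)

text \<open>
  A square matrix annihilated by \<open>x\<^sup>s\<^sup>+\<^sup>1 r\<close>, where \<open>r\<close> is a product of factors \<open>x - a\<close> with \<open>a\<close> a
  nonzero eigenvalue, and a Bezout identity for \<open>x\<^sup>s\<^sup>+\<^sup>1\<close> and \<open>r\<close>. The exponent is positive, also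
  for nonsingular matrices, so that \<open>x\<^sup>s\<close> makes sense in the polynomial of the Drazin inverse.
\<close>

locale fitting_decomposition =
  fixes A :: "'a::field mat" and n s :: nat and as :: "'a list" and u v :: "'a poly"
  assumes A: "A \<in> carrier_mat n n"
    and nonzero: "0 \<notin> set as"
    and eigenvalues: "\<And>a. a \<in> set as \<Longrightarrow> eigenvalue A a"
    and bezout: "[:0, 1:] ^ Suc s * u + (\<Prod>a\<leftarrow>as. [:- a, 1:]) * v = 1"
    and annihilator: "mat_poly n A ([:0, 1:] ^ Suc s * (\<Prod>a\<leftarrow>as. [:- a, 1:])) = 0\<^sub>m n n"
begin

abbreviation "X \<equiv> [:0, 1:] :: 'a poly"
abbreviation "P \<equiv> mat_poly n A"

text \<open>
  The classes of \<open>\<phi>\<close> and \<open>\<epsilon>\<close> modulo \<open>x\<^sup>s\<^sup>+\<^sup>1 r\<close> are complementary idempotents; \<open>\<epsilon>(A)\<close> will be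
  the spectral projection at 0. Since \<open>x b = \<phi>\<^sup>2\<close>, the polynomial \<open>b\<close> inverts \<open>x\<close> on the part cut
  out by \<open>\<phi>\<close>; \<open>b(A)\<close> will be the Drazin inverse.
\<close>

definition "r = (\<Prod>a\<leftarrow>as. [:- a, 1:])"
definition "\<phi> = X ^ Suc s * u"
definition "\<epsilon> = r * v"
definition "b = X ^ s * u * \<phi>"

lemma phi_plus_eps: "\<phi> + \<epsilon> = 1"
  using bezout by (simp add: \<phi>_def \<epsilon>_def r_def)

lemma phi_eq: "\<phi> = 1 - \<epsilon>"
  using phi_plus_eps by (simp add: algebra_simps)

lemma X_b: "X * b = \<phi> * \<phi>"
  unfolding b_def \<phi>_def power_Suc by (simp only: mult_ac)

lemma P_cong: "p - q = X ^ Suc s * r * c \<Longrightarrow> P p = P q"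
  by (rule mat_poly_cong[OF A annihilator]) (simp only: r_def dvd_triv_left)

lemma P_cong_phi_eps:
  assumes "p - q = \<phi> * \<epsilon> * c"
  shows "P p = P q"
  by (rule P_cong[of _ _ "u * v * c"]) (simp only: assms, simp only: \<phi>_def \<epsilon>_def mult_ac)

lemma P_phi_idem: "P (\<phi> * \<phi> * p) = P (\<phi> * p)"
  by (rule P_cong_phi_eps[of _ _ "- p"]) (simp only: phi_eq, simp add: algebra_simps)

lemma P_b_phi: "P (b * \<phi>) = P b"
proof -
  have "P (b * \<phi>) = P (\<phi> * \<phi> * (X ^ s * u))" by (simp only: b_def mult_ac)
  then show ?thesis unfolding P_phi_idem by (simp only: b_def mult_ac)
qed

lemma P_X [simp]: "P X = A" by (rule mat_poly_X[OF A])

lemma P_X_power [simp]: "P (X ^ k) = A ^\<^sub>m k" by (simp add: mat_poly_power[OF A])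

lemma P_mult: "P (p * q) = P p * P q" by (rule mat_poly_mult[OF A])

lemma P_carrier [simp]: "P p \<in> carrier_mat n n" by (rule mat_poly_carrier[OF A])

lemma P_b_power: "P b ^\<^sub>m k = P (b ^ k)" by (simp add: mat_poly_power[OF A])

lemma P_vec_mult: "x \<in> carrier_vec n \<Longrightarrow> P (p * q) *\<^sub>v x = P p *\<^sub>v (P q *\<^sub>v x)"
  unfolding P_mult by (rule assoc_mult_mat_vec[OF P_carrier P_carrier])

lemma P_vec_zero: "P p *\<^sub>v 0\<^sub>v n = 0\<^sub>v n"
  using carrier_matD[OF P_carrier[of p]] by (intro eq_vecI) (auto simp: scalar_prod_def)

lemma P_vec_decompose:
  assumes "p + q = 1" "x \<in> carrier_vec n"
  shows "x = P p *\<^sub>v x + P q *\<^sub>v x"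
proof -
  have "P p *\<^sub>v x + P q *\<^sub>v x = P (p + q) *\<^sub>v x"
    unfolding mat_poly_add[OF A] using assms by (intro add_mult_distrib_mat_vec[OF P_carrier P_carrier, symmetric]) auto
  then show ?thesis using assms by (simp add: mat_poly_1[OF A])
qed

lemma pow_b: "A ^\<^sub>m Suc s * P b * A = A ^\<^sub>m Suc s"
proof -
  have "A ^\<^sub>m Suc s * P b * A = P (X ^ Suc s * b * X)" by (simp only: P_mult P_X_power P_X)
  also have "\<dots> = P (X ^ Suc s)"
  proof (rule P_cong)
    have "X ^ Suc s * b * X - X ^ Suc s = X ^ Suc s * (X * b - 1)"
      by (simp only: right_diff_distrib mult_1_right) (simp only: mult_ac)
    also have "X * b - 1 = \<epsilon> * (\<epsilon> - 2)"
      unfolding X_b phi_eq by (simp add: algebra_simps)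
    finally show "X ^ Suc s * b * X - X ^ Suc s = X ^ Suc s * r * (v * (\<epsilon> - 2))"
      by (simp only: \<epsilon>_def mult_ac)
  qed
  finally show ?thesis by (simp only: P_X_power)
qed

lemma drazin_inverse_eq: "drazin_inverse n A = P b"
proof (rule drazin_inverse_eqI[OF A _ pow_b])
  show "A * P b = P b * A" using P_mult[of X b] P_mult[of b X] by (simp add: mult.commute)
  have "P b * A * P b = P (b * X * b)" by (simp only: P_mult P_X)
  also have "b * X * b = \<phi> * \<phi> * b" unfolding X_b[symmetric] by (simp only: mult_ac)
  also have "P \<dots> = P (b * \<phi>)" unfolding P_phi_idem by (simp only: mult.commute)
  finally show "P b * A * P b = P b" unfolding P_b_phi .
qed simp

text \<open>
  The powers of \<open>A\<close> on the nonsingular part, for all integer exponents; the value at 0 is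
  \<open>\<phi>(A)\<close>, not the identity matrix.
\<close>

definition bilateral_power :: "int \<Rightarrow> 'a mat" where
  "bilateral_power k = (if 0 \<le> k then P (X ^ nat k * \<phi>) else P (b ^ nat (- k)))"

lemma bilateral_power_carrier [simp]: "bilateral_power k \<in> carrier_mat n n"
  by (simp add: bilateral_power_def)

lemma bilateral_power_step: "bilateral_power (k + 1) = A * bilateral_power k"
proof -
  consider "k \<ge> 0" | "k = -1" | "k < -1" by linarith
  then show ?thesis
  proof cases
    case 1
    then have "nat (k + 1) = Suc (nat k)" by simp
    then have "bilateral_power (k + 1) = P (X * (X ^ nat k * \<phi>))"
      using 1 unfolding bilateral_power_def by (simp only: power_Suc mult.assoc) simp
    then show ?thesis using 1 by (simp only: P_mult[of X] P_X) (simp add: bilateral_power_def)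
  next
    case 2
    have "A * P b = P (X * b)" by (simp only: P_mult P_X)
    also have "\<dots> = P \<phi>" unfolding X_b using P_phi_idem[of 1] by simp
    finally show ?thesis using 2 by (simp add: bilateral_power_def)
  next
    case 3
    define j where "j = nat (- k) - 2"
    have j: "nat (- k) = Suc (Suc j)" "nat (- (k + 1)) = Suc j" using 3 by (auto simp: j_def)
    have "A * P (b ^ Suc (Suc j)) = P (X * b ^ Suc (Suc j))" by (simp only: P_mult[of X] P_X)
    also have "X * b ^ Suc (Suc j) = \<phi> * \<phi> * b ^ Suc j"
      unfolding X_b[symmetric] power_Suc[of b "Suc j"] by (simp only: mult_ac)
    also have "P \<dots> = P (b * \<phi>) * P (b ^ j)"
      unfolding P_phi_idem P_mult[symmetric] power_Suc by (simp only: mult_ac)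
    also have "\<dots> = P (b ^ Suc j)" unfolding P_b_phi P_mult[symmetric] by simp
    finally show ?thesis using 3 j by (simp add: bilateral_power_def)
  qed
qed

lemma bilateral_power_add: "bilateral_power (k + int l) = A ^\<^sub>m l * bilateral_power k"
proof (induction l)
  case 0
  then show ?case using A left_mult_one_mat[OF bilateral_power_carrier[of k]] by simp
next
  case (Suc l)
  have "bilateral_power (k + int (Suc l)) = A * (A ^\<^sub>m l * bilateral_power k)"
    using bilateral_power_step[of "k + int l"] Suc by (simp add: add_ac)
  then show ?case using A
    by (simp add: pow_mat_Suc_left[OF A] assoc_mult_mat[of _ n n _ n _ n] del: pow_mat.simps)
qed

lemma P_r_bilateral_power: "P r * bilateral_power k = 0\<^sub>m n n"
proof -
  have z: "P (r * (\<phi> * c)) = 0\<^sub>m n n" for c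
  proof -
    have "P (r * (\<phi> * c)) = P 0"
      by (rule P_cong[of _ _ "u * c"]) (simp only: \<phi>_def diff_zero mult_ac)
    then show ?thesis by (simp add: mat_poly_0[OF A])
  qed
  show ?thesis
  proof (cases "0 \<le> k")
    case True
    then show ?thesis
      unfolding bilateral_power_def using z[of "X ^ nat k"] by (simp add: P_mult[symmetric] mult.commute)
  next
    case False
    then obtain j where "nat (- k) = Suc j" by (cases "nat (- k)") auto
    then have e: "r * b ^ nat (- k) = r * (\<phi> * (X ^ s * u * b ^ j))"
      by (simp only: power_Suc b_def mult_ac)
    have "P r * bilateral_power k = P (r * b ^ nat (- k))"
      using False by (simp add: bilateral_power_def P_mult)
    then show ?thesis unfolding e z .
  qed
qed

lemma bilateral_power_entry_in_exp_polys:
  assumes ij: "i < n" "j < n"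
  shows "(\<lambda>k. bilateral_power k $$ (i, j)) \<in> exp_polys"
proof (rule recurrence_solution_in_exp_polys[OF nonzero])
  have "shift_poly r (\<lambda>k. bilateral_power k $$ (i, j)) k = 0" for k
  proof -
    have "shift_poly r (\<lambda>k. bilateral_power k $$ (i, j)) k = (P r * bilateral_power k) $$ (i, j)"
      unfolding shift_poly_def bilateral_power_add
      by (rule mat_poly_mult_entry[OF A bilateral_power_carrier ij, symmetric])
    then show ?thesis using ij by (simp add: P_r_bilateral_power)
  qed
  then show "shift_poly (\<Prod>a\<leftarrow>as. [:- a, 1:]) (\<lambda>k. bilateral_power k $$ (i, j)) = (\<lambda>k. 0)"
    by (simp add: r_def fun_eq_iff)
qed

lemma bilateral_power_eventually:
  assumes "k > s"
  shows "bilateral_power (int k) = A ^\<^sub>m k"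
proof -
  obtain d where d: "k = Suc s + d" using assms less_iff_Suc_add by auto
  have "P (X ^ k * \<phi>) = P (X ^ k)"
  proof (rule P_cong)
    have "X ^ k * \<phi> - X ^ k = - (X ^ k * \<epsilon>)"
      unfolding phi_eq by (simp only: right_diff_distrib mult_1_right) simp
    then show "X ^ k * \<phi> - X ^ k = X ^ Suc s * r * (- (X ^ d * v))"
      unfolding d power_add \<epsilon>_def by (simp only: mult_ac mult_minus_right)
  qed
  then show ?thesis by (simp add: bilateral_power_def)
qed

lemma bilateral_power_neg:
  "P b ^\<^sub>m k = bilateral_power (- int k) + (if k = 0 then P \<epsilon> else 0\<^sub>m n n)"
proof (cases "k = 0")
  case True
  have "P \<phi> + P \<epsilon> = 1\<^sub>m n"
    using phi_plus_eps mat_poly_add[OF A, of \<phi> \<epsilon>] mat_poly_1[OF A] by simp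
  then show ?thesis using True A by (simp add: bilateral_power_def mat_poly_dim[OF A])
next
  case False
  then show ?thesis
    by (simp add: bilateral_power_def P_b_power right_add_zero_mat[of _ n n])
qed

lemma P_X_power_eps: "P (\<epsilon> * X ^ Suc s) = 0\<^sub>m n n"
proof -
  have "P (\<epsilon> * X ^ Suc s) = P 0"
    by (rule P_cong[of _ _ v]) (simp only: \<epsilon>_def diff_zero mult_ac)
  then show ?thesis by (simp add: mat_poly_0[OF A])
qed

text \<open>
  The only property of the index that is needed: the generalized kernel is already killed by
  \<open>A\<^sup>t\<close>, with \<open>t\<close> the index. Some exponent has the rank property, namely \<open>s + 1\<close>, so the
  least one has it as well; then \<open>A\<^sup>t = A\<^sup>t\<^sup>+\<^sup>j Z\<close> can be solved for \<open>Z\<close> for every \<open>j\<close>.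
\<close>

lemma P_eps_index_power: "P \<epsilon> * A ^\<^sub>m mat_index n A = 0\<^sub>m n n"
proof -
  let ?t = "mat_index n A"
  have "vec_space.rank n (A ^\<^sub>m Suc s) = vec_space.rank n (A ^\<^sub>m (Suc s + 1))"
  proof (rule rank_eq_if_factors[of _ n _ "P b" A])
    show "A ^\<^sub>m Suc s = A ^\<^sub>m (Suc s + 1) * P b"
    proof -
      have "A ^\<^sub>m Suc s = P (X ^ Suc s * b * X)" using pow_b by (simp only: P_mult P_X_power P_X)
      also have "X ^ Suc s * b * X = X ^ (Suc s + 1) * b"
        unfolding power_add power_one_right by (simp only: mult_ac)
      finally show ?thesis by (simp only: P_mult P_X_power)
    qed
  qed (use A in auto)
  then have "vec_space.rank n (A ^\<^sub>m ?t) = vec_space.rank n (A ^\<^sub>m (?t + 1))"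
    unfolding mat_index_def by (rule LeastI)
  then obtain Y where Y: "Y \<in> carrier_mat n n" "A ^\<^sub>m ?t = A ^\<^sub>m (?t + 1) * Y"
    using rank_pow_eq_imp_factor[OF A] by blast
  have "\<exists>Z\<in>carrier_mat n n. A ^\<^sub>m ?t = P (X ^ (j + ?t)) * Z" for j
  proof (induction j)
    case 0
    show ?case by (rule bexI[of _ "1\<^sub>m n"]) (use A in simp_all)
  next
    case (Suc j)
    then obtain Z where Z: "Z \<in> carrier_mat n n" "A ^\<^sub>m ?t = P (X ^ (j + ?t)) * Z" by blast
    have "P (X ^ (j + ?t)) = P (X ^ j) * A ^\<^sub>m ?t" by (simp only: power_add P_mult P_X_power)
    also have "\<dots> = P (X ^ j) * (P (X ^ (?t + 1)) * Y)"
      unfolding P_X_power by (subst Y(2)) (rule refl)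
    also have "\<dots> = P (X ^ j * X ^ (?t + 1)) * Y"
      unfolding P_mult by (rule assoc_mult_mat[OF P_carrier P_carrier Y(1), symmetric])
    also have "X ^ j * X ^ (?t + 1) = X ^ (Suc j + ?t)" unfolding power_add[symmetric] by simp
    finally have e: "P (X ^ (j + ?t)) = P (X ^ (Suc j + ?t)) * Y" .
    have "A ^\<^sub>m ?t = P (X ^ (Suc j + ?t)) * (Y * Z)"
      using Z(2) unfolding e assoc_mult_mat[OF P_carrier Y(1) Z(1)] .
    then show ?case by (rule bexI[OF _ mult_carrier_mat[OF Y(1) Z(1)]])
  qed
  then obtain Z where Z: "Z \<in> carrier_mat n n" "A ^\<^sub>m ?t = P (X ^ (Suc s + ?t)) * Z" by blast
  have "P \<epsilon> * A ^\<^sub>m ?t = P (\<epsilon> * X ^ (Suc s + ?t)) * Z"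
    unfolding Z(2) P_mult by (rule assoc_mult_mat[symmetric]) (rule P_carrier Z(1))+
  also have "P (\<epsilon> * X ^ (Suc s + ?t)) = 0\<^sub>m n n"
    unfolding power_add mult.assoc[symmetric] P_mult[of "\<epsilon> * X ^ Suc s"] P_X_power_eps
    by (rule left_mult_zero_mat) (rule P_carrier)
  finally show ?thesis unfolding left_mult_zero_mat[OF Z(1)] .
qed

lemma P_phi_factor: "P \<phi> = P (b ^ j * \<phi>) * A ^\<^sub>m j"
proof (induction j)
  case 0
  have "dim_col (P \<phi>) = n" by (rule mat_poly_dim[OF A])
  then show ?case using A by simp
next
  case (Suc j)
  have "P (b ^ Suc j * \<phi>) * A ^\<^sub>m Suc j = P (b ^ Suc j * \<phi> * X ^ Suc j)"
    by (simp only: P_mult P_X_power)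
  also have "b ^ Suc j * \<phi> * X ^ Suc j = \<phi> * \<phi> * (\<phi> * b ^ j * X ^ j)"
    unfolding X_b[symmetric] power_Suc by (simp only: mult_ac)
  also have "P \<dots> = P (\<phi> * (\<phi> * b ^ j * X ^ j))" by (rule P_phi_idem)
  also have "\<phi> * (\<phi> * b ^ j * X ^ j) = \<phi> * \<phi> * (b ^ j * X ^ j)" by (simp only: mult_ac)
  also have "P \<dots> = P (\<phi> * (b ^ j * X ^ j))" by (rule P_phi_idem)
  also have "\<phi> * (b ^ j * X ^ j) = b ^ j * \<phi> * X ^ j" by (simp only: mult_ac)
  also have "P \<dots> = P (b ^ j * \<phi>) * A ^\<^sub>m j" by (simp only: P_mult P_X_power)
  finally have "P (b ^ Suc j * \<phi>) * A ^\<^sub>m Suc j = P (b ^ j * \<phi>) * A ^\<^sub>m j" .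
  from Suc this[symmetric] show ?case by (rule trans)
qed

lemma gen_eigenspace_subset: "gen_eigenspace A a \<subseteq> carrier_vec n"
  unfolding gen_eigenspace_def
  by (rule UN_least, rule subsetI)
    (rule mat_kernelD(1)[OF pow_carrier_mat[OF char_matrix_closed[OF A]]])

lemma gen_eigenspace_iff:
  "x \<in> gen_eigenspace A a \<longleftrightarrow> x \<in> carrier_vec n \<and> (\<exists>k. P ([:- a, 1:] ^ k) *\<^sub>v x = 0\<^sub>v n)"
proof -
  have "char_matrix A a ^\<^sub>m k = P ([:- a, 1:] ^ k)" for k
    by (simp add: mat_poly_power[OF A] mat_poly_linear[OF A])
  then show ?thesis unfolding gen_eigenspace_def
    using mat_kernel[OF P_carrier] by auto
qed

text \<open>
  Primary decomposition of the kernel of a product of linear factors: a Bezout identity splits off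
  the component belonging to one root \<open>a\<close>, which is a generalized eigenvector, and the rest
  belongs to the remaining roots.
\<close>

lemma kernel_in_nonzero_gen_eigenspaces:
  assumes "set bs \<subseteq> set as" "x \<in> carrier_vec n" "P (\<Prod>a\<leftarrow>bs. [:- a, 1:]) *\<^sub>v x = 0\<^sub>v n"
  shows "x \<in> nonzero_gen_eigenspaces n A"
  using assms
proof (induction bs arbitrary: x rule: length_induct)
  case (1 bs)
  interpret V: vec_space "TYPE('a)" n .
  let ?G = "\<Union>a\<in>{a. eigenvalue A a \<and> a \<noteq> 0}. gen_eigenspace A a"
  have G: "?G \<subseteq> carrier_vec n" using gen_eigenspace_subset by blast
  show ?case
  proof (cases bs)
    case Nil
    then have "x = 0\<^sub>v n" using 1 by (simp add: mat_poly_1[OF A])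
    then show ?thesis unfolding nonzero_gen_eigenspaces_def
      using vectorspace.span_zero[OF V.vectorspace_axioms, of ?G] by simp
  next
    case (Cons a bs')
    define cs where "cs = filter (\<lambda>b. b \<noteq> a) bs"
    define p where "p = (\<Prod>b\<leftarrow>cs. [:- b, 1:])"
    define l where "l = count_list bs a"
    have split: "(\<Prod>b\<leftarrow>bs. [:- b, 1:]) = [:- a, 1:] ^ l * p"
      unfolding l_def p_def cs_def by (rule prod_linear_split)
    have "poly p a \<noteq> 0" by (simp add: p_def poly_prod_linear_eq_0_iff cs_def)
    then obtain u' v' where uv: "[:- a, 1:] ^ l * u' + p * v' = 1"
      by (rule linear_power_bezout)
    let ?y = "P ([:- a, 1:] ^ l * u') *\<^sub>v x" and ?z = "P (p * v') *\<^sub>v x"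
    have yz: "x = ?y + ?z" by (rule P_vec_decompose[OF uv 1(3)])
    have kill: "P (c * (\<Prod>b\<leftarrow>bs. [:- b, 1:])) *\<^sub>v x = 0\<^sub>v n" for c
      unfolding P_vec_mult[OF 1(3)] 1(4) by (rule P_vec_zero)
    have c: "?y \<in> carrier_vec n" "?z \<in> carrier_vec n"
      using 1(3) by (auto intro: mult_mat_vec_carrier[of _ n n])
    have "?y \<in> nonzero_gen_eigenspaces n A"
    proof (rule 1(1)[rule_format, of cs])
      show "length cs < length bs" unfolding cs_def Cons by (simp add: le_imp_less_Suc)
      show "set cs \<subseteq> set as" using 1(2) by (auto simp: cs_def)
      have "P p *\<^sub>v ?y = P (u' * (\<Prod>b\<leftarrow>bs. [:- b, 1:])) *\<^sub>v x"
        unfolding P_vec_mult[OF 1(3), symmetric] split by (simp only: mult_ac)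
      then show "P (\<Prod>a\<leftarrow>cs. [:- a, 1:]) *\<^sub>v ?y = 0\<^sub>v n" using kill by (simp add: p_def)
    qed (rule c)
    moreover have "?z \<in> nonzero_gen_eigenspaces n A"
    proof -
      have "P ([:- a, 1:] ^ l) *\<^sub>v ?z = P (v' * (\<Prod>b\<leftarrow>bs. [:- b, 1:])) *\<^sub>v x"
        unfolding P_vec_mult[OF 1(3), symmetric] split by (simp only: mult_ac)
      then have "?z \<in> gen_eigenspace A a" using kill c by (auto simp: gen_eigenspace_iff)
      moreover have "eigenvalue A a" "a \<noteq> 0"
        using 1(2) nonzero eigenvalues Cons by auto
      ultimately have "?z \<in> ?G" by blast
      then show ?thesis unfolding nonzero_gen_eigenspaces_def
        by (intro V.span_mem) (use G in simp_all)
    qed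
    ultimately have "?y + ?z \<in> nonzero_gen_eigenspaces n A"
      unfolding nonzero_gen_eigenspaces_def
      using V.span_add1[of ?G ?y ?z] G by simp
    then show ?thesis using yz by simp
  qed
qed

lemma nonzero_gen_eigenspaces_eq: "nonzero_gen_eigenspaces n A = mat_kernel (P \<epsilon>)"
proof
  interpret V: vec_space "TYPE('a)" n .
  show "mat_kernel (P \<epsilon>) \<subseteq> nonzero_gen_eigenspaces n A"
  proof
    fix x assume "x \<in> mat_kernel (P \<epsilon>)"
    then have x: "x \<in> carrier_vec n" "P \<epsilon> *\<^sub>v x = 0\<^sub>v n" using mat_kernelD[OF P_carrier] by auto
    show "x \<in> nonzero_gen_eigenspaces n A"
    proof (rule kernel_in_nonzero_gen_eigenspaces[OF subset_refl x(1)])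
      have "P r *\<^sub>v x = P (r * 1) *\<^sub>v x" by simp
      also have "P (r * 1) = P (r * \<epsilon>)"
      proof (rule P_cong)
        have "r * 1 - r * \<epsilon> = r * \<phi>" unfolding phi_eq by (simp only: right_diff_distrib)
        then show "r * 1 - r * \<epsilon> = X ^ Suc s * r * u" by (simp only: \<phi>_def mult_ac)
      qed
      also have "P (r * \<epsilon>) *\<^sub>v x = 0\<^sub>v n" unfolding P_vec_mult[OF x(1)] x(2) by (rule P_vec_zero)
      finally show "P (\<Prod>a\<leftarrow>as. [:- a, 1:]) *\<^sub>v x = 0\<^sub>v n" by (simp add: r_def)
    qed
  qed
  show "nonzero_gen_eigenspaces n A \<subseteq> mat_kernel (P \<epsilon>)"
    unfolding nonzero_gen_eigenspaces_def
  proof (rule V.span_is_subset)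
    show "submodule class_ring (mat_kernel (P \<epsilon>)) (module_vec TYPE('a) n)"
    proof (unfold_locales)
      show "mat_kernel (P \<epsilon>) \<subseteq> carrier (module_vec TYPE('a) n)"
        using mat_kernel[OF P_carrier[of \<epsilon>]] by auto
    next
      fix y z assume "y \<in> mat_kernel (P \<epsilon>)" "z \<in> mat_kernel (P \<epsilon>)"
      then show "y \<oplus>\<^bsub>module_vec TYPE('a) n\<^esub> z \<in> mat_kernel (P \<epsilon>)"
        using mat_kernel[OF P_carrier[of \<epsilon>]] mult_add_distrib_mat_vec[OF P_carrier[of \<epsilon>]] by auto
    next
      show "\<zero>\<^bsub>module_vec TYPE('a) n\<^esub> \<in> mat_kernel (P \<epsilon>)"
        using mat_kernel[OF P_carrier[of \<epsilon>]] P_vec_zero by auto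
    next
      fix c y assume "c \<in> carrier (class_ring :: 'a ring)" "y \<in> mat_kernel (P \<epsilon>)"
      then show "c \<odot>\<^bsub>module_vec TYPE('a) n\<^esub> y \<in> mat_kernel (P \<epsilon>)"
        using mat_kernel_smult[OF P_carrier[of \<epsilon>]] by (auto simp: module_vec_def)
    qed
    show "(\<Union>a\<in>{a. eigenvalue A a \<and> a \<noteq> 0}. gen_eigenspace A a) \<subseteq> mat_kernel (P \<epsilon>)"
    proof
      fix x assume "x \<in> (\<Union>a\<in>{a. eigenvalue A a \<and> a \<noteq> 0}. gen_eigenspace A a)"
      then obtain a k where a: "a \<noteq> 0" and x: "x \<in> carrier_vec n"
        and k: "P ([:- a, 1:] ^ k) *\<^sub>v x = 0\<^sub>v n"
        by (auto simp: gen_eigenspace_iff)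
      \<comment> \<open>The vector \<open>\<epsilon>(A) x\<close> is killed by \<open>A\<^sup>s\<^sup>+\<^sup>1\<close> and by \<open>(A - a)\<^sup>k\<close>, whose polynomials are coprime.\<close>
      have "poly (X ^ Suc s) a \<noteq> 0" using a by (simp add: poly_power)
      then obtain c d where cd: "[:- a, 1:] ^ k * c + X ^ Suc s * d = 1"
        by (rule linear_power_bezout)
      have "P (\<epsilon> * ([:- a, 1:] ^ k * c)) *\<^sub>v x = P (\<epsilon> * c * [:- a, 1:] ^ k) *\<^sub>v x"
        by (simp only: mult_ac)
      also have "\<dots> = 0\<^sub>v n" unfolding P_vec_mult[OF x] k by (simp only: P_vec_zero)
      finally have 1: "P (\<epsilon> * ([:- a, 1:] ^ k * c)) *\<^sub>v x = 0\<^sub>v n" .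
      have "P (\<epsilon> * (X ^ Suc s * d)) = P (\<epsilon> * X ^ Suc s) * P d"
        by (simp only: mult.assoc[symmetric] P_mult)
      then have 2: "P (\<epsilon> * (X ^ Suc s * d)) *\<^sub>v x = 0\<^sub>v n"
        unfolding P_X_power_eps left_mult_zero_mat[OF P_carrier]
        using x by (auto simp: scalar_prod_def)
      have "\<epsilon> = \<epsilon> * ([:- a, 1:] ^ k * c) + \<epsilon> * (X ^ Suc s * d)"
        unfolding distrib_left[symmetric] cd by simp
      then have "P \<epsilon> *\<^sub>v x = P (\<epsilon> * ([:- a, 1:] ^ k * c) + \<epsilon> * (X ^ Suc s * d)) *\<^sub>v x"
        by (rule arg_cong[where f = "\<lambda>p. P p *\<^sub>v x"])
      also have "\<dots> = (P (\<epsilon> * ([:- a, 1:] ^ k * c)) + P (\<epsilon> * (X ^ Suc s * d))) *\<^sub>v x"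
        by (simp only: mat_poly_add[OF A])
      also have "\<dots> = 0\<^sub>v n"
        by (subst add_mult_distrib_mat_vec[of _ n n]) (use x 1 2 in simp_all)
      finally show "x \<in> mat_kernel (P \<epsilon>)" using x by (intro mat_kernelI[OF P_carrier])
    qed
  qed
qed

lemma is_projection_eps:
  "is_projection n (mat_kernel (A ^\<^sub>m mat_index n A)) (nonzero_gen_eigenspaces n A) (P \<epsilon>)"
  unfolding is_projection_def nonzero_gen_eigenspaces_eq
proof (intro conjI refl P_carrier)
  let ?t = "mat_index n A"
  have At: "A ^\<^sub>m ?t \<in> carrier_mat n n" using A by simp
  have "P (\<epsilon> * \<epsilon>) = P \<epsilon>"
    by (rule P_cong_phi_eps[of _ _ "-1"]) (simp only: phi_eq, simp add: algebra_simps)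
  then show "P \<epsilon> * P \<epsilon> = P \<epsilon>" by (simp only: P_mult)
  show "(\<lambda>x. P \<epsilon> *\<^sub>v x) ` carrier_vec n = mat_kernel (A ^\<^sub>m ?t)"
  proof (intro equalityI subsetI)
    fix y assume "y \<in> (\<lambda>x. P \<epsilon> *\<^sub>v x) ` carrier_vec n"
    then obtain x where x: "x \<in> carrier_vec n" "y = P \<epsilon> *\<^sub>v x" by blast
    have "A ^\<^sub>m ?t *\<^sub>v y = (P (X ^ ?t) * P \<epsilon>) *\<^sub>v x"
      unfolding x(2) P_X_power by (rule assoc_mult_mat_vec[OF At P_carrier x(1), symmetric])
    also have "P (X ^ ?t) * P \<epsilon> = P \<epsilon> * A ^\<^sub>m ?t"
      using mat_poly_commute[OF A, of "X ^ ?t" \<epsilon>] by simp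
    also have "(P \<epsilon> * A ^\<^sub>m ?t) *\<^sub>v x = 0\<^sub>v n" unfolding P_eps_index_power using x by (auto simp: scalar_prod_def)
    finally show "y \<in> mat_kernel (A ^\<^sub>m ?t)"
      using x by (intro mat_kernelI[OF At]) (auto intro: mult_mat_vec_carrier[of _ n n])
  next
    fix x assume "x \<in> mat_kernel (A ^\<^sub>m ?t)"
    then have x: "x \<in> carrier_vec n" "A ^\<^sub>m ?t *\<^sub>v x = 0\<^sub>v n" using mat_kernelD[OF At] by auto
    have "P \<phi> *\<^sub>v x = P (b ^ ?t * \<phi>) *\<^sub>v (A ^\<^sub>m ?t *\<^sub>v x)"
      by (subst P_phi_factor[of ?t]) (use x At in \<open>simp add: assoc_mult_mat_vec[of _ n n]\<close>)
    also have "\<dots> = 0\<^sub>v n" unfolding x(2) by (rule P_vec_zero)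
    finally have "x = 0\<^sub>v n + P \<epsilon> *\<^sub>v x"
      using P_vec_decompose[OF phi_plus_eps x(1)] by simp
    then have "x = P \<epsilon> *\<^sub>v x"
      unfolding left_zero_vec[OF mult_mat_vec_carrier[OF P_carrier x(1)]] .
    then show "x \<in> (\<lambda>x. P \<epsilon> *\<^sub>v x) ` carrier_vec n" using x by blast
  qed
qed

lemma spectral_proj0_eq: "spectral_proj0 n A (mat_index n A) = P \<epsilon>"
  unfolding spectral_proj0_def
  by (rule the_equality, rule is_projection_eps) (rule is_projection_unique[OF _ is_projection_eps])

end

section \<open>The power sequence of the Drazin inverse\<close>

lemma power_seq_in_L_seqs:
  fixes A :: "'a::field mat"
  assumes A: "A \<in> carrier_mat q q" and s: "splits (char_poly A)"
  shows "mat_of_seq q (\<lambda>k. A ^\<^sub>m k) \<in> L_seqs q"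
proof -
  have "(\<Sum>l\<le>degree (char_poly A). coeff (char_poly A) l * (mat_of_seq q (\<lambda>k. A ^\<^sub>m k) $$ (i, j)) (k + l)) = 0"
    if ij: "i < q" "j < q" for i j k
  proof -
    have "A ^\<^sub>m (k + l) = A ^\<^sub>m l * A ^\<^sub>m k" for l
      using mat_poly_mult[OF A, of "[:0, 1:] ^ l" "[:0, 1:] ^ k"]
      by (simp add: power_add[symmetric] mat_poly_power[OF A] mat_poly_X[OF A] add.commute)
    then have "(\<Sum>l\<le>degree (char_poly A). coeff (char_poly A) l * (mat_of_seq q (\<lambda>k. A ^\<^sub>m k) $$ (i, j)) (k + l))
      = (mat_poly q A (char_poly A) * A ^\<^sub>m k) $$ (i, j)"
      using mat_poly_mult_entry[OF A pow_carrier_mat[OF A] ij] ij by (simp add: mat_of_seq_def del: index_mult_mat)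
    then show ?thesis
      unfolding mat_poly_char_poly[OF A] using ij A by (simp add: left_mult_zero_mat[of _ q q])
  qed
  then show ?thesis
    unfolding L_seqs_def using degree_monic_char_poly[OF A] s by (auto simp: mat_of_seq_def)
qed

theorem theorem4p1:
  fixes A :: "'a::field mat" and q t0 :: nat
  assumes "A \<in> carrier_mat q q"
    and "mat_index q A = t0"
    and "splits (char_poly A)"
  shows "mat_of_seq q (\<lambda>k. drazin_inverse q A ^\<^sub>m k) =
      theta0 q (mat_of_seq q (\<lambda>k. A ^\<^sub>m k))
      + zero_seq 0 \<cdot>\<^sub>m map_mat const_seq (spectral_proj0 q A t0)"
proof -
  note A = assms(1)
  obtain as where as: "char_poly A = (\<Prod>a\<leftarrow>as. [:- a, 1:])"
    using assms(3) degree_monic_char_poly[OF A] by (auto simp: splits_def)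
  define s where "s = count_list as 0"
  define as' where "as' = filter (\<lambda>a. a \<noteq> 0) as"
  have split: "char_poly A = [:0, 1:] ^ s * (\<Prod>a\<leftarrow>as'. [:- a, 1:])"
    unfolding as s_def as'_def using prod_linear_split[of as 0] by simp
  have "poly (\<Prod>a\<leftarrow>as'. [:- a, 1:]) 0 \<noteq> 0"
    by (simp add: poly_prod_linear_eq_0_iff as'_def)
  then obtain u v where uv: "[:- 0, 1:] ^ Suc s * u + (\<Prod>a\<leftarrow>as'. [:- a, 1:]) * v = 1"
    by (rule linear_power_bezout)
  interpret fitting_decomposition A q s as' u v
  proof
    show "A \<in> carrier_mat q q" by (rule A)
    show "0 \<notin> set as'" by (simp add: as'_def)
    show "eigenvalue A a" if "a \<in> set as'" for a
      using that eigenvalue_root_char_poly[OF A, of a] unfolding as poly_prod_linear_eq_0_iff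
      by (simp add: as'_def)
    show "[:0, 1:] ^ Suc s * u + (\<Prod>a\<leftarrow>as'. [:- a, 1:]) * v = 1" using uv by simp
    have "[:0, 1:] ^ Suc s * (\<Prod>a\<leftarrow>as'. [:- a, 1:]) = [:0, 1:] * char_poly A"
      unfolding split power_Suc by (simp only: mult_ac)
    then show "mat_poly q A ([:0, 1:] ^ Suc s * (\<Prod>a\<leftarrow>as'. [:- a, 1:])) = 0\<^sub>m q q"
      using A by (simp only: mat_poly_mult[OF A] mat_poly_char_poly[OF A] mat_poly_X[OF A] right_mult_zero_mat)
  qed
  have "theta0 q (mat_of_seq q (\<lambda>k. A ^\<^sub>m k))
      = mat q q (\<lambda>(i, j) k. bilateral_power (- int k) $$ (i, j))"
    by (rule theta0_of_exp_polys[OF power_seq_in_L_seqs[OF A assms(3)], of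
          "\<lambda>i j k. bilateral_power k $$ (i, j)" s])
      (simp_all add: bilateral_power_entry_in_exp_polys bilateral_power_eventually mat_of_seq_def)
  moreover have "(P b ^\<^sub>m k) $$ (i, j)
      = bilateral_power (- int k) $$ (i, j) + zero_seq 0 k * P \<epsilon> $$ (i, j)"
    if ij: "i < q" "j < q" for i j k
    unfolding bilateral_power_neg using ij carrier_matD[OF P_carrier[of \<epsilon>]]
    by (simp add: zero_seq_def)
  ultimately show ?thesis
    unfolding drazin_inverse_eq assms(2)[symmetric] spectral_proj0_eq
    using carrier_matD[OF P_carrier[of \<epsilon>]]
    by (intro eq_matI) (auto simp: mat_of_seq_def const_seq_def fun_eq_iff)
qed

end
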